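(* Let $d\in\mathbb{N}$, fix $0<\alpha<1/2$, let $G$ be a trace-zero GUE matrix on $\mathbb{C}^d\otimes\mathbb{C}^d$, and set \[ \rho=\frac{1}{d^2}\left(\mathbb{1}+\frac{\alpha}{d}G\right). \] Then $\mathbb{P}\big(\rho\geq 0\text{ and }\rho^\Gamma\geq 0\big)\geq 1-2e^{-c_\alpha d^2}$, where $c_\alpha>0$ is a constant depending only on $\alpha$.
   Context: Trace-zero GUE matrix on $\mathbb{C}^n$ ($n=d^2$): let $\tilde G$ be an $n\times n$ matrix with independent complex Gaussian entries of mean $0$ and variance $1$, let $G'=(\tilde G+\tilde G^\dagger)/\sqrt2$, and $G=G'-(\mathrm{tr}\,G')\mathbb{1}/n$. $\rho^\Gamma=(\mathrm{id}\otimes T)(\rho)$ with $T$ the transposition in the computational basis on the second factor $\mathbb{C}^d$. The event in the claim is that $\rho$ is a PPT state. *)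

theory Defs
  imports "HOL-Probability.Probability"
begin

text \<open>Standard complex Gaussian N_C(0,1): density exp(-|z|^2)/pi w.r.t. Lebesgue measure on C
  (real and imaginary parts independent N(0,1/2), so E|z|^2 = 1).\<close>
definition cgauss :: "complex measure" where
  "cgauss = density lborel (\<lambda>z. ennreal (exp (- (cmod z)\<^sup>2) / pi))"

text \<open>Index set of the computational basis of C^d \<otimes> C^d: pairs (a,b) with a,b < d.\<close>
definition Idx :: "nat \<Rightarrow> (nat \<times> nat) set" where
  "Idx d = {..<d} \<times> {..<d}"

definition gue_space :: "nat \<Rightarrow> ((nat \<times> nat) \<times> (nat \<times> nat) \<Rightarrow> complex) measure" where
  "gue_space d = PiM (Idx d \<times> Idx d) (\<lambda>_. cgauss)"

type_synonym cmat = "nat \<times> nat \<Rightarrow> nat \<times> nat \<Rightarrow> complex"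

definition Gprime :: "((nat \<times> nat) \<times> (nat \<times> nat) \<Rightarrow> complex) \<Rightarrow> cmat" where
  "Gprime g i j = (g (i, j) + cnj (g (j, i))) / complex_of_real (sqrt 2)"

definition Gtz :: "nat \<Rightarrow> ((nat \<times> nat) \<times> (nat \<times> nat) \<Rightarrow> complex) \<Rightarrow> cmat" where
  "Gtz d g i j = Gprime g i j -
     (if i = j then (\<Sum>k\<in>Idx d. Gprime g k k) / of_nat (d^2) else 0)"

definition rho :: "real \<Rightarrow> nat \<Rightarrow> ((nat \<times> nat) \<times> (nat \<times> nat) \<Rightarrow> complex) \<Rightarrow> cmat" where
  "rho \<alpha> d g i j = (1 / of_nat (d^2)) *
     ((if i = j then 1 else 0) + complex_of_real (\<alpha> / real d) * Gtz d g i j)"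

definition ptrans :: "cmat \<Rightarrow> cmat" where
  "ptrans A i j = A (fst i, snd j) (fst j, snd i)"

definition psd :: "(nat \<times> nat) set \<Rightarrow> cmat \<Rightarrow> bool" where
  "psd I A \<longleftrightarrow> (\<forall>v :: nat \<times> nat \<Rightarrow> complex.
     let q = (\<Sum>i\<in>I. \<Sum>j\<in>I. cnj (v i) * A i j * v j) in Im q = 0 \<and> Re q \<ge> 0)"

end

theory Submission
  imports Defs
begin

text \<open>For a unit vector $v$ put $X_v = -\langle v, G v\rangle + \xi$ with an independent real Gaussian
  $\xi$ of variance $1 + 1/n$, and $Y_v = 2\,\mathrm{Re}\langle v, h\rangle$ with a standard complex Gaussian
  vector $h$ of length $n = d^2$. Both processes have variance $2$, and with $s = \langle v, w\rangle$ their
  covariances are $|s|^2 + 1 \ge 2\,\mathrm{Re}\, s$. Slepian's comparison therefore makes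
  $\max_v X_v$ stochastically smaller than $\max_v Y_v \le 2 |h|$, and $|h|$ exceeds $(1 + \delta)\sqrt{n}$
  with probability exponentially small in $n$. Since $\rho$ fails to be positive only if some
  $-\langle v, G v\rangle$ exceeds $d/\alpha > 2\sqrt{n}$, this settles $\rho \ge 0$. Partial
  transposition merely permutes the independent entries of the Gaussian matrix and fixes its
  diagonal, so $\rho^\Gamma$ has the law of $\rho$ and a union bound finishes the proof.\<close>

section \<open>Complex Gaussian measure\<close>

text \<open>A union bound over a net of the sphere loses a constant factor in the threshold and
  would not reach every \<alpha> < 1/2. The comparison gives a bound that is the same for every
  finite set of unit vectors, so it passes by a monotone limit to a countable dense set, which is
  enough to detect a failure of positivity. The noise \<xi> is there because Slepian needs equal
  variances: the form alone has variance 1 - 1/n. It is shared by all v, so it shifts every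
  covariance by the same amount, and removing it costs only a factor 2. The rate is that of a
  Chernoff bound for |h|^2, a sum of n independent exponential variables of mean 1: exceeding r n
  with r > 1 has rate r - 1 - ln r. Here r = \<sigma>^2 / 4 for a \<sigma> strictly between 2 and
  1/\<alpha>. The prefactors collected on the way are absorbed by taking a quarter of this
  rate.\<close>

lemma normal_density_tendsto_0:
  assumes "\<sigma> > 0"
  shows "((normal_density 0 \<sigma>) \<longlongrightarrow> 0) at_top" "((normal_density 0 \<sigma>) \<longlongrightarrow> 0) at_bot"
proof -
  show "((normal_density 0 \<sigma>) \<longlongrightarrow> 0) at_top"
    unfolding normal_density_def using assms by real_asymp
  show "((normal_density 0 \<sigma>) \<longlongrightarrow> 0) at_bot"
    unfolding normal_density_def using assms by real_asymp
qed

text \<open>Stein's identity. The density n satisfies n'(x) = -(x / \<sigma>^2) n(x), so the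
  difference of the two integrands is the derivative of -\<sigma>^2 f n. Boundedness of f and f'
  makes both integrals exist and the boundary terms vanish.\<close>

lemma normal_integration_by_parts:
  fixes f f' :: "real \<Rightarrow> real"
  assumes "\<sigma> > 0"
    and f: "\<And>x. (f has_real_derivative f' x) (at x)"
    and cont: "continuous_on UNIV f'"
    and bd: "\<And>x. \<bar>f x\<bar> \<le> B" "\<And>x. \<bar>f' x\<bar> \<le> B"
  shows "(\<integral>x. x * f x \<partial>density lborel (normal_density 0 \<sigma>))
       = \<sigma>\<^sup>2 * (\<integral>x. f' x \<partial>density lborel (normal_density 0 \<sigma>))"
proof -
  let ?n = "normal_density 0 \<sigma>"
  let ?g = "\<lambda>x. ?n x * (x * f x) - \<sigma>\<^sup>2 * (?n x * f' x)"
  have f_cont: "continuous_on UNIV f"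
    by (meson DERIV_isCont continuous_at_imp_continuous_on f)
  have [measurable]: "f \<in> borel_measurable borel" "f' \<in> borel_measurable borel"
    using f_cont cont by (auto intro: borel_measurable_continuous_onI)
  have nd: "(?n has_real_derivative - (x / \<sigma>\<^sup>2) * ?n x) (at x)" for x
    unfolding normal_density_def using \<open>\<sigma> > 0\<close>
    by (auto intro!: derivative_eq_intros simp: field_simps)
  have F: "((\<lambda>x. - \<sigma>\<^sup>2 * (f x * ?n x)) has_real_derivative ?g x) (at x)" for x
    by (auto intro!: derivative_eq_intros f nd simp: field_simps assms(1)[THEN less_imp_neq, symmetric])
  have i1: "integrable lborel (\<lambda>x. ?n x * (x * f x))"
  proof (rule Bochner_Integration.integrable_bound)
    show "integrable lborel (\<lambda>x. B * (?n x * \<bar>x - 0\<bar>^1))"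
      by (intro integrable_mult_right integrable_normal_moment_abs assms)
    have "\<bar>f x\<bar> \<le> \<bar>B\<bar>" for x
      using bd(1)[of x] by linarith
    then show "AE x in lborel. norm (?n x * (x * f x)) \<le> norm (B * (?n x * \<bar>x - 0\<bar>^1))"
      by (intro always_eventually allI)
        (simp add: abs_mult mult_ac, metis abs_ge_zero mult.commute mult_left_mono normal_density_nonneg)
  qed simp
  have i2: "integrable lborel (\<lambda>x. ?n x * f' x)"
  proof (rule Bochner_Integration.integrable_bound)
    show "integrable lborel (\<lambda>x. B * ?n x)"
      by (intro integrable_mult_right integrable_normal_density assms)
    have "\<bar>f' x\<bar> \<le> \<bar>B\<bar>" for x
      using bd(2)[of x] by linarith
    then show "AE x in lborel. norm (?n x * f' x) \<le> norm (B * ?n x)"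
      by (intro always_eventually allI)
        (simp add: abs_mult mult_ac mult_right_mono)
  qed simp
  have lim: "((\<lambda>x. - \<sigma>\<^sup>2 * (f x * ?n x)) \<longlongrightarrow> 0) F" if "(?n \<longlongrightarrow> 0) F" for F
  proof (rule tendsto_mult_right_zero, rule tendsto_0_le[OF that, of _ B])
    show "\<forall>\<^sub>F x in F. norm (f x * ?n x) \<le> norm (?n x) * B"
      using bd(1) by (intro always_eventually allI)
        (simp add: abs_mult mult.commute[of _ B] mult_right_mono)
  qed
  have "(LBINT x=-\<infinity>..\<infinity>. ?g x) = 0 - 0"
  proof (rule interval_integral_FTC_integrable[where F = "\<lambda>x. - \<sigma>\<^sup>2 * (f x * ?n x)"])
    show "((\<lambda>x. - \<sigma>\<^sup>2 * (f x * ?n x)) has_vector_derivative ?g x) (at x)" for x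
      using F by (simp add: has_real_derivative_iff_has_vector_derivative)
    show "isCont ?g x" for x
      using cont f_cont nd[THEN DERIV_isCont] by (auto intro!: continuous_intros simp: continuous_on_eq_continuous_at)
    show "set_integrable lborel (einterval (-\<infinity>) \<infinity>) ?g"
      using i1 i2 by (simp add: set_integrable_def)
    show "(((\<lambda>x. - \<sigma>\<^sup>2 * (f x * ?n x)) \<circ> real_of_ereal) \<longlongrightarrow> 0) (at_right (- \<infinity>))"
      "(((\<lambda>x. - \<sigma>\<^sup>2 * (f x * ?n x)) \<circ> real_of_ereal) \<longlongrightarrow> 0) (at_left \<infinity>)"
      using lim[OF normal_density_tendsto_0(1)[OF \<open>\<sigma> > 0\<close>]] lim[OF normal_density_tendsto_0(2)[OF \<open>\<sigma> > 0\<close>]]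
      by (simp_all only: ereal_tendsto_simps)
  qed simp
  then have "(\<integral>x. ?g x \<partial>lborel) = 0"
    by (simp add: interval_lebesgue_integral_def set_lebesgue_integral_def)
  then show ?thesis
    using i1 i2 by (simp add: integral_density)
qed

section \<open>The complex plane as a product of two real lines\<close>

lemma Complex_measurable [measurable]:
  assumes [measurable]: "f \<in> borel_measurable M" "g \<in> borel_measurable M"
  shows "(\<lambda>x. Complex (f x) (g x)) \<in> borel_measurable M"
  unfolding Complex_eq by measurable

lemma lborel_complex_eq: "lborel = distr (lborel \<Otimes>\<^sub>M lborel) borel (\<lambda>(x, y). Complex x y)"
proof (rule lborel_eqI)
  fix l u :: complex
  assume le: "\<And>b. b \<in> Basis \<Longrightarrow> l \<bullet> b \<le> u \<bullet> b"
  have le': "Re l \<le> Re u" "Im l \<le> Im u"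
    using le[of 1] le[of \<i>] by (auto simp: Basis_complex_def)
  have eq: "(\<lambda>(x, y). Complex x y) -` box l u \<inter> space (lborel \<Otimes>\<^sub>M lborel)
      = {Re l<..<Re u} \<times> {Im l<..<Im u}"
    by (auto simp: box_def Basis_complex_def space_pair_measure)
  have [measurable]: "(\<lambda>(x, y). Complex x y) \<in> (lborel \<Otimes>\<^sub>M lborel) \<rightarrow>\<^sub>M borel"
    by measurable
  show "emeasure (distr (lborel \<Otimes>\<^sub>M lborel) borel (\<lambda>(x, y). Complex x y)) (box l u) = (\<Prod>b\<in>Basis. (u - l) \<bullet> b)"
    using le' by (subst emeasure_distr)
      (simp_all add: eq lborel.emeasure_pair_measure_Times Basis_complex_def ennreal_mult[symmetric])
qed simp

text \<open>The radial density factors over real and imaginary part, each with variance 1/(2a). The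
  parameter a is kept general because \<open>cgauss\<close> is the case a = 1, while exponential
  tilts of it need a = 1 - t.\<close>

lemma complex_gauss_density:
  assumes "a > 0"
  defines "N \<equiv> density lborel (normal_density 0 (1 / sqrt (2 * a)))"
  shows "density lborel (\<lambda>z. ennreal (a / pi * exp (- a * (cmod z)\<^sup>2)))
       = distr (N \<Otimes>\<^sub>M N) borel (\<lambda>(x, y). Complex x y)"
proof -
  have [measurable]: "(\<lambda>(x, y). Complex x y) \<in> (lborel \<Otimes>\<^sub>M lborel) \<rightarrow>\<^sub>M borel"
    by measurable
  let ?n = "normal_density 0 (1 / sqrt (2 * a))"
  have NN: "N \<Otimes>\<^sub>M N = density (lborel \<Otimes>\<^sub>M lborel) (\<lambda>(x, y). ennreal (?n x) * ennreal (?n y))"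
    unfolding N_def
    by (intro pair_measure_density sigma_finite_lborel)
      (auto intro!: prob_space_imp_sigma_finite prob_space_normal_density assms)
  have e: "ennreal (a / pi * exp (- a * (cmod (Complex x y))\<^sup>2)) = ennreal (?n x) * ennreal (?n y)" for x y
  proof -
    have "?n x * ?n y = a / pi * (exp (- a * x\<^sup>2) * exp (- a * y\<^sup>2))"
      using assms by (simp add: normal_density_def power_divide real_sqrt_divide real_sqrt_mult[symmetric] field_simps)
    also have "\<dots> = a / pi * exp (- a * (cmod (Complex x y))\<^sup>2)"
      by (simp add: exp_add[symmetric] cmod_power2 algebra_simps)
    finally show ?thesis
      by (simp add: ennreal_mult[symmetric])
  qed
  have "density lborel (\<lambda>z. ennreal (a / pi * exp (- a * (cmod z)\<^sup>2)))
    = density (distr (lborel \<Otimes>\<^sub>M lborel) borel (\<lambda>(x, y). Complex x y)) (\<lambda>z. ennreal (a / pi * exp (- a * (cmod z)\<^sup>2)))"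
    by (simp only: lborel_complex_eq[symmetric])
  also have "\<dots> = distr (density (lborel \<Otimes>\<^sub>M lborel) (\<lambda>z. ennreal (a / pi * exp (- a * (cmod (case z of (x, y) \<Rightarrow> Complex x y))\<^sup>2)))) borel (\<lambda>(x, y). Complex x y)"
    by (subst density_distr) auto
  also have "(\<lambda>z. ennreal (a / pi * exp (- a * (cmod (case z of (x, y) \<Rightarrow> Complex x y))\<^sup>2)))
      = (\<lambda>(x, y). ennreal (?n x) * ennreal (?n y))"
    by (auto simp: fun_eq_iff e[symmetric])
  finally show ?thesis
    by (simp add: NN)
qed

lemma cgauss_eq_distr:
  defines "N \<equiv> density lborel (normal_density 0 (1 / sqrt 2))"
  shows "cgauss = distr (N \<Otimes>\<^sub>M N) borel (\<lambda>(x, y). Complex x y)"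
  using complex_gauss_density[of 1] by (simp add: N_def cgauss_def)

lemma space_cgauss [simp]: "space cgauss = UNIV"
  and sets_cgauss [simp, measurable_cong]: "sets cgauss = sets borel"
  by (simp_all add: cgauss_def)

text \<open>Multiplying the density by exp(t |z|^2) gives 1/(1 - t) times the Gaussian density with
  parameter 1 - t, whose mass is 1. The case t = 0 yields that \<open>cgauss\<close> is a
  probability measure; other t serve in the Chernoff bound.\<close>

lemma cgauss_exp_square:
  fixes t :: real
  assumes "t < 1"
  shows "has_bochner_integral cgauss (\<lambda>z. exp (t * (cmod z)\<^sup>2)) (1 / (1 - t))"
proof (rule has_bochner_integral_nn_integral)
  let ?a = "1 - t"
  let ?N = "density lborel (normal_density 0 (1 / sqrt (2 * ?a)))"
  interpret N: prob_space ?N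
    by (intro prob_space_normal_density) (use assms in auto)
  interpret NN: pair_prob_space ?N ?N ..
  have [measurable]: "(\<lambda>(x, y). Complex x y) \<in> (?N \<Otimes>\<^sub>M ?N) \<rightarrow>\<^sub>M borel"
    by measurable
  interpret D: prob_space "distr (?N \<Otimes>\<^sub>M ?N) borel (\<lambda>(x, y). Complex x y)"
    by (rule NN.prob_space_distr) simp
  have "(\<integral>\<^sup>+z. ennreal (exp (t * (cmod z)\<^sup>2)) \<partial>cgauss)
      = (\<integral>\<^sup>+z. ennreal (exp (- (cmod z)\<^sup>2) / pi) * ennreal (exp (t * (cmod z)\<^sup>2)) \<partial>lborel)"
    unfolding cgauss_def by (subst nn_integral_density) auto
  also have "\<dots> = (\<integral>\<^sup>+z. ennreal (1 / ?a) * ennreal (?a / pi * exp (- ?a * (cmod z)\<^sup>2)) \<partial>lborel)"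
  proof (rule nn_integral_cong)
    fix z
    have "exp (- (cmod z)\<^sup>2) * exp (t * (cmod z)\<^sup>2) = exp (- ?a * (cmod z)\<^sup>2)"
      by (simp add: mult_exp_exp algebra_simps)
    then show "ennreal (exp (- (cmod z)\<^sup>2) / pi) * ennreal (exp (t * (cmod z)\<^sup>2))
        = ennreal (1 / ?a) * ennreal (?a / pi * exp (- ?a * (cmod z)\<^sup>2))"
      using assms by (simp add: ennreal_mult[symmetric])
  qed
  also have "\<dots> = ennreal (1 / ?a) * emeasure (density lborel (\<lambda>z. ennreal (?a / pi * exp (- ?a * (cmod z)\<^sup>2)))) UNIV"
    by (subst nn_integral_cmult) (auto simp: emeasure_density)
  also have "\<dots> = ennreal (1 / ?a)"
    using D.emeasure_space_1 assms by (subst complex_gauss_density) auto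
  finally show "(\<integral>\<^sup>+z. ennreal (exp (t * (cmod z)\<^sup>2)) \<partial>cgauss) = ennreal (1 / ?a)" .
qed (use assms in auto)

lemma prob_space_cgauss: "prob_space cgauss"
proof
  have "(\<integral>\<^sup>+z. 1 \<partial>cgauss) = 1"
    using nn_integral_eq_integral[of cgauss "\<lambda>z. exp (0 * (cmod z)\<^sup>2)"] cgauss_exp_square[of 0]
    by (simp add: has_bochner_integral_iff)
  then show "emeasure cgauss (space cgauss) = 1" by simp
qed

interpretation cgauss: prob_space cgauss by (rule prob_space_cgauss)

lemma integrable_cgauss_cmod: "integrable cgauss cmod"
proof (rule Bochner_Integration.integrable_bound)
  show "integrable cgauss (\<lambda>z. exp (1/2 * (cmod z)\<^sup>2))"
    using cgauss_exp_square[of "1/2"] by (simp add: has_bochner_integral_iff)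
  have "r \<le> exp (1/2 * r\<^sup>2)" for r :: real
  proof -
    have "0 \<le> (r - 1)\<^sup>2" by simp
    then have "r \<le> 1 + 1/2 * r\<^sup>2" by (simp add: power2_eq_square algebra_simps)
    also have "\<dots> \<le> exp (1/2 * r\<^sup>2)" by (rule exp_ge_add_one_self)
    finally show ?thesis .
  qed
  then show "AE z in cgauss. norm (cmod z) \<le> norm (exp (1/2 * (cmod z)\<^sup>2))" by simp
qed simp

text \<open>Stein's identity in each real coordinate, combined by Fubini. \<open>D\<close> is the
  real gradient of \<open>F\<close> written as a complex number, and the factor 1/2 is the variance
  of a single real coordinate.\<close>

lemma cgauss_integration_by_parts:
  fixes F :: "complex \<Rightarrow> real" and D :: "complex \<Rightarrow> complex"
  assumes F: "\<And>z. (F has_derivative (\<lambda>h. D z \<bullet> h)) (at z)"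
    and cont: "continuous_on UNIV D"
    and bd: "\<And>z. \<bar>F z\<bar> \<le> B" "\<And>z. cmod (D z) \<le> B"
  shows "(\<integral>z. (b \<bullet> z) * F z \<partial>cgauss) = 1/2 * (\<integral>z. b \<bullet> D z \<partial>cgauss)"
proof -
  define N where "N = density lborel (normal_density 0 (1 / sqrt 2))"
  interpret N: prob_space N
    unfolding N_def by (intro prob_space_normal_density) auto
  interpret NN: pair_prob_space N N ..
  have [measurable_cong]: "sets N = sets borel" and [simp]: "space N = UNIV"
    by (simp_all add: N_def)
  have F_cont: "continuous_on UNIV F"
    using F by (meson continuous_at_imp_continuous_on has_derivative_continuous)
  have [measurable]: "F \<in> borel_measurable borel" "D \<in> borel_measurable borel"
    using F_cont cont by (auto intro: borel_measurable_continuous_onI)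
  let ?C = "\<lambda>(x, y). Complex x y"
  have [measurable]: "?C \<in> (N \<Otimes>\<^sub>M N) \<rightarrow>\<^sub>M borel" by measurable
  have ceq: "cgauss = distr (N \<Otimes>\<^sub>M N) borel ?C"
    using cgauss_eq_distr by (simp add: N_def)
  have integ: "integrable (N \<Otimes>\<^sub>M N) (\<lambda>(x, y). G (Complex x y))" if "integrable cgauss G" for G :: "complex \<Rightarrow> real"
  proof -
    have "integrable (N \<Otimes>\<^sub>M N) (\<lambda>x. G (?C x))"
      using that unfolding ceq by (intro integrable_distr[of ?C]) auto
    then show ?thesis by (simp add: case_prod_beta')
  qed
  have eval: "(\<integral>z. G z \<partial>cgauss) = (\<integral>p. (\<lambda>(x, y). G (Complex x y)) p \<partial>(N \<Otimes>\<^sub>M N))"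
    if [measurable]: "G \<in> borel_measurable borel" for G :: "complex \<Rightarrow> real"
    unfolding ceq by (subst integral_distr) (auto simp: case_prod_beta')
  have iF: "integrable cgauss (\<lambda>z. G z * F z)"
    if [measurable]: "G \<in> borel_measurable borel" and "\<And>z. \<bar>G z\<bar> \<le> cmod z" for G
  proof (rule Bochner_Integration.integrable_bound)
    show "integrable cgauss (\<lambda>z. cmod z * B)"
      by (intro integrable_mult_left integrable_cgauss_cmod)
    show "AE z in cgauss. norm (G z * F z) \<le> norm (cmod z * B)"
      using bd(1) that by (intro always_eventually allI)
        (auto simp: abs_mult intro!: mult_mono intro: order_trans[OF bd(1) abs_ge_self])
  qed simp
  have iD: "integrable cgauss (\<lambda>z. G (D z))"
    if [measurable]: "G \<in> borel_measurable borel" and "\<And>z. \<bar>G z\<bar> \<le> cmod z" for G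
    using order_trans[OF that(2) bd(2)]
    by (intro cgauss.integrable_const_bound[where B = B]) auto
  have iRe: "integrable cgauss (\<lambda>z. Re z * F z)" "integrable cgauss (\<lambda>z. Im z * F z)"
    by (rule iF; simp add: abs_Re_le_cmod abs_Im_le_cmod)+
  have iDRe: "integrable cgauss (\<lambda>z. Re (D z))" "integrable cgauss (\<lambda>z. Im (D z))"
    by (rule iD; simp add: abs_Re_le_cmod abs_Im_le_cmod)+
  have bRe: "\<bar>Re (D z)\<bar> \<le> B" "\<bar>Im (D z)\<bar> \<le> B" for z
    using bd(2)[of z] abs_Re_le_cmod[of "D z"] abs_Im_le_cmod[of "D z"] by linarith+
  have dRe: "((\<lambda>x. F (Complex x y)) has_real_derivative Re (D (Complex x y))) (at x)" for x y
    unfolding has_field_derivative_def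
    by (rule has_derivative_eq_rhs, rule has_derivative_compose[where g = F, OF _ F])
      (auto intro!: derivative_eq_intros simp: Complex_eq inner_complex_def)
  have dIm: "((\<lambda>y. F (Complex x y)) has_real_derivative Im (D (Complex x y))) (at y)" for x y
    unfolding has_field_derivative_def
    by (rule has_derivative_eq_rhs, rule has_derivative_compose[where g = F, OF _ F])
      (auto intro!: derivative_eq_intros simp: Complex_eq inner_complex_def)
  have cRe: "continuous_on UNIV (\<lambda>x. Re (D (Complex x y)))" for y
    by (intro continuous_intros continuous_on_compose2[OF cont]) (auto simp: Complex_eq intro!: continuous_intros)
  have cIm: "continuous_on UNIV (\<lambda>y. Im (D (Complex x y)))" for x
    by (intro continuous_intros continuous_on_compose2[OF cont]) (auto simp: Complex_eq intro!: continuous_intros)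
  have ReI: "(\<integral>z. Re z * F z \<partial>cgauss) = 1/2 * (\<integral>z. Re (D z) \<partial>cgauss)"
  proof -
    have "(\<integral>z. Re z * F z \<partial>cgauss) = (\<integral>y. (\<integral>x. x * F (Complex x y) \<partial>N) \<partial>N)"
      using integ[OF iRe(1)] by (subst eval) (auto simp: NN.integral_snd[symmetric])
    also have "\<dots> = (\<integral>y. 1/2 * (\<integral>x. Re (D (Complex x y)) \<partial>N) \<partial>N)"
      unfolding N_def
      by (subst normal_integration_by_parts[OF _ dRe cRe bd(1) bRe(1)]) (auto simp: power_divide)
    also have "\<dots> = 1/2 * (\<integral>z. Re (D z) \<partial>cgauss)"
      using integ[OF iDRe(1)] by (subst eval) (auto simp: NN.integral_snd[symmetric])
    finally show ?thesis .
  qed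
  have ImI: "(\<integral>z. Im z * F z \<partial>cgauss) = 1/2 * (\<integral>z. Im (D z) \<partial>cgauss)"
  proof -
    have "(\<integral>z. Im z * F z \<partial>cgauss) = (\<integral>x. (\<integral>y. y * F (Complex x y) \<partial>N) \<partial>N)"
      using integ[OF iRe(2)] by (subst eval) (auto simp: NN.integral_fst'[symmetric])
    also have "\<dots> = (\<integral>x. 1/2 * (\<integral>y. Im (D (Complex x y)) \<partial>N) \<partial>N)"
      unfolding N_def
      by (subst normal_integration_by_parts[OF _ dIm cIm bd(1) bRe(2)]) (auto simp: power_divide)
    also have "\<dots> = 1/2 * (\<integral>z. Im (D z) \<partial>cgauss)"
      using integ[OF iDRe(2)] by (subst eval) (auto simp: NN.integral_fst'[symmetric])
    finally show ?thesis .
  qed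
  have "(\<integral>z. (b \<bullet> z) * F z \<partial>cgauss) = (\<integral>z. Re b * (Re z * F z) + Im b * (Im z * F z) \<partial>cgauss)"
    by (simp add: inner_complex_def algebra_simps)
  also have "\<dots> = Re b * (\<integral>z. Re z * F z \<partial>cgauss) + Im b * (\<integral>z. Im z * F z \<partial>cgauss)"
    using iRe by simp
  also have "\<dots> = 1/2 * (\<integral>z. Re b * Re (D z) + Im b * Im (D z) \<partial>cgauss)"
    unfolding ReI ImI using iDRe by (simp add: algebra_simps)
  finally show ?thesis by (simp add: inner_complex_def)
qed

text \<open>The mean value theorem bounds every difference quotient by \<open>w\<close>, which does
  not depend on t, so dominated convergence applies along each sequence tending to 0.\<close>

lemma has_real_derivative_integral:
  fixes f f' :: "real \<Rightarrow> 'a \<Rightarrow> real"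
  assumes deriv: "\<And>t x. ((\<lambda>t. f t x) has_real_derivative f' t x) (at t)"
    and integ: "\<And>t. integrable M (f t)"
    and [measurable]: "\<And>t. f' t \<in> borel_measurable M"
    and bound: "\<And>t x. \<bar>f' t x\<bar> \<le> w x" and w: "integrable M w"
  shows "((\<lambda>t. \<integral>x. f t x \<partial>M) has_real_derivative (\<integral>x. f' t x \<partial>M)) (at t)"
  unfolding DERIV_def tendsto_at_iff_sequentially comp_def
proof (intro allI impI)
  fix X :: "nat \<Rightarrow> real"
  assume X: "\<forall>n. X n \<in> UNIV - {0}" "X \<longlonglongrightarrow> 0"
  have [measurable]: "f t \<in> borel_measurable M" for t
    using integ by auto
  have "(\<lambda>n. \<integral>x. (f (t + X n) x - f t x) / X n \<partial>M) \<longlonglongrightarrow> (\<integral>x. f' t x \<partial>M)"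
  proof (rule integral_dominated_convergence[OF _ _ w])
    show "AE x in M. (\<lambda>n. (f (t + X n) x - f t x) / X n) \<longlonglongrightarrow> f' t x"
      using deriv X unfolding DERIV_def tendsto_at_iff_sequentially comp_def by auto
    have "\<bar>f (t + h) x - f t x\<bar> \<le> w x * \<bar>t + h - t\<bar>" for h x
      using field_differentiable_bound[of UNIV "\<lambda>t. f t x" "\<lambda>t. f' t x" "w x" "t + h" t] deriv bound by auto
    then show "AE x in M. norm ((f (t + X n) x - f t x) / X n) \<le> w x" for n
      using X(1) by (intro always_eventually) (auto simp: divide_le_eq mult.commute[of _ "w _"])
  qed auto
  then show "(\<lambda>n. ((\<integral>x. f (t + X n) x \<partial>M) - (\<integral>x. f t x \<partial>M)) / X n) \<longlonglongrightarrow> (\<integral>x. f' t x \<partial>M)"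
    by (simp add: integ)
qed

section \<open>Finite products of complex Gaussians\<close>

lemma product_prob_space_cgauss: "product_prob_space (\<lambda>_. cgauss)"
  by (simp add: product_prob_space_def product_prob_space_axioms_def product_sigma_finite_def
      prob_space_cgauss cgauss.sigma_finite_measure_axioms)

lemma integrable_PiM_cgauss_component:
  fixes f :: "complex \<Rightarrow> real"
  assumes "i \<in> J" "integrable cgauss f"
  shows "integrable (\<Pi>\<^sub>M _\<in>J. cgauss) (\<lambda>g. f (g i))"
proof -
  interpret product_prob_space "\<lambda>_. cgauss" J by (rule product_prob_space_cgauss)
  show ?thesis
    using assms by (intro integrable_distr[of "\<lambda>g. g i" _ cgauss]) (auto simp: PiM_component)
qed

text \<open>Fubini integrates coordinate \<open>i\<close> innermost, where the one-variable identity
  applies with the other coordinates frozen. Hence \<open>D\<close> is only the partial gradient in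
  coordinate \<open>i\<close>.\<close>

lemma PiM_cgauss_integration_by_parts:
  fixes F :: "('i \<Rightarrow> complex) \<Rightarrow> real" and D :: "('i \<Rightarrow> complex) \<Rightarrow> complex"
  assumes J: "finite J" "i \<in> J"
    and meas [measurable]: "F \<in> borel_measurable (\<Pi>\<^sub>M _\<in>J. cgauss)" "D \<in> borel_measurable (\<Pi>\<^sub>M _\<in>J. cgauss)"
    and F: "\<And>g z. ((\<lambda>z. F (g(i := z))) has_derivative (\<lambda>h. D (g(i := z)) \<bullet> h)) (at z)"
    and cont: "\<And>g. continuous_on UNIV (\<lambda>z. D (g(i := z)))"
    and bd: "\<And>g. \<bar>F g\<bar> \<le> B" "\<And>g. cmod (D g) \<le> B"
  shows "(\<integral>g. (b \<bullet> g i) * F g \<partial>(\<Pi>\<^sub>M _\<in>J. cgauss)) = 1/2 * (\<integral>g. b \<bullet> D g \<partial>(\<Pi>\<^sub>M _\<in>J. cgauss))"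
proof -
  interpret product_prob_space "\<lambda>_::'i. cgauss" J by (rule product_prob_space_cgauss)
  have ins: "insert i (J - {i}) = J" using J by auto
  have [measurable]: "(\<lambda>g. g i) \<in> borel_measurable (\<Pi>\<^sub>M _\<in>J. cgauss)"
    using J measurable_component_singleton[of i J "\<lambda>_. cgauss"] by simp
  have "integrable (\<Pi>\<^sub>M _\<in>J. cgauss) (\<lambda>g. (b \<bullet> g i) * F g)"
  proof (rule Bochner_Integration.integrable_bound)
    show "integrable (\<Pi>\<^sub>M _\<in>J. cgauss) (\<lambda>g. cmod b * cmod (g i) * B)"
      by (intro integrable_mult_left integrable_mult_right integrable_PiM_cgauss_component J integrable_cgauss_cmod)
    show "AE g in \<Pi>\<^sub>M _\<in>J. cgauss. norm ((b \<bullet> g i) * F g) \<le> norm (cmod b * cmod (g i) * B)"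
      using bd(1) by (intro always_eventually allI)
        (auto simp: abs_mult norm_mult intro!: mult_mono Cauchy_Schwarz_ineq2 order_trans[OF bd(1) abs_ge_self])
  qed measurable
  then have "(\<integral>g. (b \<bullet> g i) * F g \<partial>(\<Pi>\<^sub>M _\<in>J. cgauss))
    = (\<integral>x. \<integral>z. (b \<bullet> z) * F (x(i := z)) \<partial>cgauss \<partial>(\<Pi>\<^sub>M _\<in>J - {i}. cgauss))"
    using product_integral_insert[of "J - {i}" i "\<lambda>g. (b \<bullet> g i) * F g"] J by (simp add: ins insert_absorb)
  also have "\<dots> = (\<integral>x. 1/2 * (\<integral>z. b \<bullet> D (x(i := z)) \<partial>cgauss) \<partial>(\<Pi>\<^sub>M _\<in>J - {i}. cgauss))"
    by (subst cgauss_integration_by_parts[OF F cont bd]) simp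
  also have "\<dots> = 1/2 * (\<integral>g. b \<bullet> D g \<partial>(\<Pi>\<^sub>M _\<in>J. cgauss))"
  proof -
    have "integrable (\<Pi>\<^sub>M _\<in>J. cgauss) (\<lambda>g. b \<bullet> D g)"
      using order_trans[OF Cauchy_Schwarz_ineq2 mult_left_mono[OF bd(2) norm_ge_zero]]
      by (intro integrable_const_bound[where B = "cmod b * B"]) auto
    then show ?thesis
      using product_integral_insert[of "J - {i}" i "\<lambda>g. b \<bullet> D g"] J by (simp add: ins insert_absorb)
  qed
  finally show ?thesis .
qed

section \<open>Slepian comparison\<close>

text \<open>Used with s the sum of all the exponentials in the smooth functional and y, y' two of
  its terms: the factor exp(-s) tames their growth, so the products arising from first and second
  derivatives are bounded uniformly in the sample.\<close>

lemma mult_exp_minus_le: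
  fixes y y' s :: real
  assumes "0 \<le> y" "y \<le> s" "0 \<le> y'" "y' \<le> s"
  shows "y * exp (- s) \<le> 1" "y * y' * exp (- s) \<le> 4"
proof -
  have "s \<le> exp s" "s / 2 \<le> exp (s / 2)"
    using exp_ge_add_one_self[of s] exp_ge_add_one_self[of "s / 2"] by linarith+
  then show "y * exp (- s) \<le> 1"
    using assms by (simp add: exp_minus field_simps)
  have "y * y' \<le> s * s" using assms by (intro mult_mono) auto
  also have "\<dots> = 4 * ((s / 2) * (s / 2))" by simp
  also have "\<dots> \<le> 4 * (exp (s / 2) * exp (s / 2))"
    using assms \<open>s / 2 \<le> _\<close> by (intro mult_left_mono mult_mono) auto
  also have "\<dots> = 4 * exp s" by (simp add: mult_exp_exp)
  finally show "y * y' * exp (- s) \<le> 4"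
    by (simp add: exp_minus field_simps)
qed

text \<open>Slepian's inequality with the indicator of $\max_v Z_v \le t$ replaced by the smooth functional
  $\exp(-\sum_v e^{\beta (Z_v - t)})$, which tends to it as $\beta \to \infty$. It is proved by interpolating
  $\cos\theta\, X + \sin\theta\, Y$; the off-diagonal second derivatives of the functional are
  nonnegative, and the diagonal ones do not contribute because the variances agree.\<close>

theorem slepian_exp:
  fixes a b :: "'v \<Rightarrow> 'i \<Rightarrow> complex" and \<beta> t :: real
  assumes J: "finite J" and V: "finite V"
    and var: "\<And>v. v \<in> V \<Longrightarrow> (\<Sum>i\<in>J. a v i \<bullet> a v i) = (\<Sum>i\<in>J. b v i \<bullet> b v i)"
    and cov: "\<And>v w. v \<in> V \<Longrightarrow> w \<in> V \<Longrightarrow> (\<Sum>i\<in>J. b v i \<bullet> b w i) \<le> (\<Sum>i\<in>J. a v i \<bullet> a w i)"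
    and cross: "\<And>v w. v \<in> V \<Longrightarrow> w \<in> V \<Longrightarrow> (\<Sum>i\<in>J. a v i \<bullet> b w i) = 0"
    and "\<beta> > 0"
  shows "(\<integral>g. exp (- (\<Sum>v\<in>V. exp (\<beta> * ((\<Sum>i\<in>J. b v i \<bullet> g i) - t)))) \<partial>(\<Pi>\<^sub>M _\<in>J. cgauss))
       \<le> (\<integral>g. exp (- (\<Sum>v\<in>V. exp (\<beta> * ((\<Sum>i\<in>J. a v i \<bullet> g i) - t)))) \<partial>(\<Pi>\<^sub>M _\<in>J. cgauss))"
proof -
  let ?M = "\<Pi>\<^sub>M _\<in>J. cgauss"
  interpret product_prob_space "\<lambda>_::'i. cgauss" J by (rule product_prob_space_cgauss)
  \<comment> \<open>\<open>c \<theta>\<close> interpolates along a quarter circle from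
    \<open>a\<close> to \<open>b\<close>, and \<open>c' \<theta>\<close> is its derivative in
    \<theta>. The circular path keeps the variance constant, since the two processes are
    uncorrelated.\<close>
  define c where "c \<theta> v i = cos \<theta> *\<^sub>R a v i + sin \<theta> *\<^sub>R b v i" for \<theta> v i
  define c' where "c' \<theta> v i = cos \<theta> *\<^sub>R b v i - sin \<theta> *\<^sub>R a v i" for \<theta> v i
  define Z where "Z \<theta> v g = (\<Sum>i\<in>J. c \<theta> v i \<bullet> g i)" for \<theta> v g
  define Z' where "Z' \<theta> v g = (\<Sum>i\<in>J. c' \<theta> v i \<bullet> g i)" for \<theta> v g
  define y where "y \<theta> v g = exp (\<beta> * (Z \<theta> v g - t))" for \<theta> v g
  define f where "f \<theta> g = exp (- (\<Sum>v\<in>V. y \<theta> v g))" for \<theta> g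
  have [measurable]: "(\<lambda>g. g i) \<in> borel_measurable ?M" if "i \<in> J" for i
    using that measurable_component_singleton[of i J "\<lambda>_. cgauss"] by simp
  have [measurable]: "Z \<theta> v \<in> borel_measurable ?M" "Z' \<theta> v \<in> borel_measurable ?M" for \<theta> v
    unfolding Z_def Z'_def by (intro borel_measurable_sum; measurable)+
  have [measurable]: "y \<theta> v \<in> borel_measurable ?M" "f \<theta> \<in> borel_measurable ?M" for \<theta> v
    unfolding y_def f_def by measurable
  have y0: "0 \<le> y \<theta> v g" for \<theta> v g by (simp add: y_def)
  have y_le: "y \<theta> v g \<le> (\<Sum>v\<in>V. y \<theta> v g)" if "v \<in> V" for \<theta> v g
    by (rule member_le_sum) (use that V y0 in auto)
  have f0: "0 \<le> f \<theta> g" "f \<theta> g \<le> 1" for \<theta> g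
    by (auto simp: f_def intro!: sum_nonneg y0)
  have yf: "0 \<le> y \<theta> v g * f \<theta> g" "y \<theta> v g * f \<theta> g \<le> 1" if "v \<in> V" for \<theta> v g
    using mult_exp_minus_le(1)[OF y0 y_le y0 y_le, OF that that] y0 f0 by (auto simp: f_def)
  have yyf: "0 \<le> y \<theta> v g * y \<theta> w g * f \<theta> g" "y \<theta> v g * y \<theta> w g * f \<theta> g \<le> 4" if "v \<in> V" "w \<in> V" for \<theta> v w g
    using mult_exp_minus_le(2)[OF y0 y_le y0 y_le, OF that] y0 f0 by (auto simp: f_def)

  have dZ: "((\<lambda>\<theta>. Z \<theta> v g) has_real_derivative Z' \<theta> v g) (at \<theta>)" for \<theta> v g
    unfolding Z_def Z'_def c_def c'_def
    by (auto intro!: derivative_eq_intros sum.cong simp: inner_diff_left inner_add_left algebra_simps)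
  have df: "((\<lambda>\<theta>. f \<theta> g) has_real_derivative - \<beta> * (\<Sum>v\<in>V. Z' \<theta> v g * (y \<theta> v g * f \<theta> g))) (at \<theta>)" for \<theta> g
    unfolding f_def y_def
    by (auto intro!: derivative_eq_intros dZ sum.cong simp: sum_distrib_left sum_distrib_right sum_negf[symmetric] algebra_simps)
  have Z'_bound: "\<bar>Z' \<theta> v g\<bar> \<le> (\<Sum>i\<in>J. (cmod (a v i) + cmod (b v i)) * cmod (g i))" for \<theta> v g
  proof -
    have "cmod (c' \<theta> v i) \<le> cmod (a v i) + cmod (b v i)" for i
    proof -
      have "cmod (c' \<theta> v i) \<le> \<bar>cos \<theta>\<bar> * cmod (b v i) + \<bar>sin \<theta>\<bar> * cmod (a v i)"
        unfolding c'_def by (rule norm_triangle_le_diff) simp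
      also have "\<dots> \<le> 1 * cmod (b v i) + 1 * cmod (a v i)"
        by (intro add_mono mult_right_mono) auto
      finally show ?thesis by simp
    qed
    then show ?thesis
      unfolding Z'_def
      by (intro order_trans[OF sum_abs] sum_mono order_trans[OF Cauchy_Schwarz_ineq2] mult_right_mono) auto
  qed
  \<comment> \<open>An integrable majorant of the \<theta>-derivative that is free of \<theta>, as
    differentiation under the integral requires.\<close>
  define W where "W g = \<beta> * (\<Sum>v\<in>V. \<Sum>i\<in>J. (cmod (a v i) + cmod (b v i)) * cmod (g i))" for g
  have W: "integrable ?M W"
    unfolding W_def
    by (intro integrable_mult_right Bochner_Integration.integrable_sum integrable_PiM_cgauss_component integrable_cgauss_cmod)
  have df_bound: "\<bar>- \<beta> * (\<Sum>v\<in>V. Z' \<theta> v g * (y \<theta> v g * f \<theta> g))\<bar> \<le> W g" for \<theta> g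
  proof -
    have "\<bar>\<Sum>v\<in>V. Z' \<theta> v g * (y \<theta> v g * f \<theta> g)\<bar> \<le> (\<Sum>v\<in>V. (\<Sum>i\<in>J. (cmod (a v i) + cmod (b v i)) * cmod (g i)) * 1)"
    proof (intro order_trans[OF sum_abs] sum_mono)
      fix v assume "v \<in> V"
      then show "\<bar>Z' \<theta> v g * (y \<theta> v g * f \<theta> g)\<bar> \<le> (\<Sum>i\<in>J. (cmod (a v i) + cmod (b v i)) * cmod (g i)) * 1"
        unfolding abs_mult[of "Z' \<theta> v g"] using yf[of v \<theta> g]
        by (intro mult_mono Z'_bound) (auto intro!: sum_nonneg)
    qed
    then show ?thesis using \<open>\<beta> > 0\<close> by (simp add: W_def abs_mult)
  qed
  have f_int: "integrable ?M (f \<theta>)" for \<theta>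
    using f0 by (intro integrable_const_bound[where B = 1]) auto
  define \<psi>' where "\<psi>' \<theta> = (\<integral>g. - \<beta> * (\<Sum>v\<in>V. Z' \<theta> v g * (y \<theta> v g * f \<theta> g)) \<partial>?M)" for \<theta>
  have d\<psi>: "((\<lambda>\<theta>. \<integral>g. f \<theta> g \<partial>?M) has_real_derivative \<psi>' \<theta>) (at \<theta>)" for \<theta>
    unfolding \<psi>'_def
    by (rule has_real_derivative_integral[OF df f_int _ df_bound W]) measurable

  \<comment> \<open>Gaussian integration by parts for y_v f. Differentiating y_v gives the first
    term, differentiating f = exp(-sum of y_w) gives the sum with its minus sign; this sign is what
    finally decides the direction of the inequality.\<close>
  have parts: "(\<integral>g. (e \<bullet> g i) * (y \<theta> v g * f \<theta> g) \<partial>?M)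
    = \<beta> / 2 * ((e \<bullet> c \<theta> v i) * (\<integral>g. y \<theta> v g * f \<theta> g \<partial>?M)
         - (\<Sum>w\<in>V. (e \<bullet> c \<theta> w i) * (\<integral>g. y \<theta> v g * y \<theta> w g * f \<theta> g \<partial>?M)))"
    if "v \<in> V" "i \<in> J" for \<theta> v i e
  proof -
    define D where "D g = (\<beta> * (y \<theta> v g * f \<theta> g)) *\<^sub>R c \<theta> v i
        - (\<Sum>w\<in>V. (\<beta> * (y \<theta> v g * y \<theta> w g * f \<theta> g)) *\<^sub>R c \<theta> w i)" for g
    have Zz: "Z \<theta> w (g(i := z)) = c \<theta> w i \<bullet> z + (\<Sum>j\<in>J - {i}. c \<theta> w j \<bullet> g j)" for w g z
      unfolding Z_def using J \<open>i \<in> J\<close> by (subst sum.remove[of _ i]) (auto intro!: sum.cong)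
    have dZ: "((\<lambda>z. Z \<theta> w (g(i := z))) has_derivative (\<lambda>h. c \<theta> w i \<bullet> h)) (at z)" for w g z
      unfolding Zz by (auto intro!: derivative_eq_intros)
    have dy: "((\<lambda>z. y \<theta> w (g(i := z))) has_derivative (\<lambda>h. \<beta> * y \<theta> w (g(i := z)) * (c \<theta> w i \<bullet> h))) (at z)" for w g z
      unfolding y_def by (rule derivative_eq_intros dZ refl)+ (auto simp: fun_eq_iff)
    have df: "((\<lambda>z. f \<theta> (g(i := z))) has_derivative (\<lambda>h. - (\<Sum>w\<in>V. \<beta> * y \<theta> w (g(i := z)) * (c \<theta> w i \<bullet> h)) * f \<theta> (g(i := z)))) (at z)" for g z
      unfolding f_def by (rule derivative_eq_intros dy refl)+
    have dF: "((\<lambda>z. y \<theta> v (g(i := z)) * f \<theta> (g(i := z))) has_derivative (\<lambda>h. D (g(i := z)) \<bullet> h)) (at z)" for g z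
      by (rule has_derivative_eq_rhs, rule has_derivative_mult[OF dy df])
        (simp add: D_def fun_eq_iff inner_diff_left inner_sum_left sum_distrib_left sum_distrib_right mult_ac)
    have yc: "continuous_on UNIV (\<lambda>z. y \<theta> w (g(i := z)))" for w g
      by (intro continuous_at_imp_continuous_on ballI has_derivative_continuous[OF dy])
    have fc: "continuous_on UNIV (\<lambda>z. f \<theta> (g(i := z)))" for g
      by (intro continuous_at_imp_continuous_on ballI has_derivative_continuous[OF df])
    have Dc: "continuous_on UNIV (\<lambda>z. D (g(i := z)))" for g
      unfolding D_def by (intro continuous_intros yc fc)
    \<comment> \<open>One constant has to bound both y_v f, which is at most 1, and its gradient;
      hence the leading 1.\<close>
    define B where "B = 1 + \<beta> * cmod (c \<theta> v i) + (\<Sum>w\<in>V. \<beta> * 4 * cmod (c \<theta> w i))"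
    have B1: "1 \<le> B"
      unfolding B_def using \<open>\<beta> > 0\<close> by (auto intro!: add_nonneg_nonneg sum_nonneg simp: add.assoc)
    have "cmod (D g) \<le> B" for g
    proof -
      have "cmod (D g) \<le> cmod ((\<beta> * (y \<theta> v g * f \<theta> g)) *\<^sub>R c \<theta> v i)
          + (\<Sum>w\<in>V. cmod ((\<beta> * (y \<theta> v g * y \<theta> w g * f \<theta> g)) *\<^sub>R c \<theta> w i))"
        unfolding D_def by (intro order_trans[OF norm_triangle_ineq4] add_mono order_refl norm_sum)
      also have "\<dots> \<le> \<beta> * 1 * cmod (c \<theta> v i) + (\<Sum>w\<in>V. \<beta> * 4 * cmod (c \<theta> w i))"
        unfolding norm_scaleR abs_mult[of \<beta>] using \<open>\<beta> > 0\<close> yf[OF that(1)] yyf[OF that(1)]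
        by (intro add_mono sum_mono mult_right_mono mult_mono) (auto simp: abs_of_nonneg)
      finally show ?thesis by (simp add: B_def)
    qed
    moreover have "\<bar>y \<theta> v g * f \<theta> g\<bar> \<le> B" for g
      using yf[OF that(1), of \<theta> g] B1 by linarith
    moreover have "D \<in> borel_measurable ?M" unfolding D_def by measurable
    ultimately have "(\<integral>g. (e \<bullet> g i) * (y \<theta> v g * f \<theta> g) \<partial>?M) = 1/2 * (\<integral>g. e \<bullet> D g \<partial>?M)"
      by (intro PiM_cgauss_integration_by_parts[OF J \<open>i \<in> J\<close> _ _ dF Dc]) auto
    also have "\<dots> = 1/2 * (\<integral>g. \<beta> * (e \<bullet> c \<theta> v i) * (y \<theta> v g * f \<theta> g)
         - (\<Sum>w\<in>V. \<beta> * (e \<bullet> c \<theta> w i) * (y \<theta> v g * y \<theta> w g * f \<theta> g)) \<partial>?M)"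
      by (simp add: D_def inner_diff_right inner_sum_right mult_ac)
    also have "\<dots> = 1/2 * (\<beta> * (e \<bullet> c \<theta> v i) * (\<integral>g. y \<theta> v g * f \<theta> g \<partial>?M)
         - (\<Sum>w\<in>V. \<beta> * (e \<bullet> c \<theta> w i) * (\<integral>g. y \<theta> v g * y \<theta> w g * f \<theta> g \<partial>?M)))"
    proof -
      have "integrable ?M (\<lambda>g. y \<theta> v g * f \<theta> g)"
        using yf[OF that(1)] by (intro integrable_const_bound[where B = 1]) auto
      moreover have "integrable ?M (\<lambda>g. y \<theta> v g * y \<theta> w g * f \<theta> g)" if "w \<in> V" for w
        using yyf[OF \<open>v \<in> V\<close> that] by (intro integrable_const_bound[where B = 4]) auto
      ultimately show ?thesis
        by (subst Bochner_Integration.integral_diff)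
          (auto intro!: Bochner_Integration.integrable_sum integrable_mult_right simp: Bochner_Integration.integral_sum)
    qed
    finally show ?thesis
      by (simp add: algebra_simps sum_distrib_left)
  qed

  \<comment> \<open>Up to the factor 1/2 this is the covariance of Z'_v and Z_w. By
    \<open>cross\<close> the mixed terms vanish; the remaining difference is zero for v = w by
    \<open>var\<close> and nonpositive in general by \<open>cov\<close>.\<close>
  have cov': "(\<Sum>i\<in>J. c' \<theta> v i \<bullet> c \<theta> w i)
      = sin \<theta> * cos \<theta> * ((\<Sum>i\<in>J. b v i \<bullet> b w i) - (\<Sum>i\<in>J. a v i \<bullet> a w i))" if "v \<in> V" "w \<in> V" for \<theta> v w
  proof -
    have "(\<Sum>i\<in>J. c' \<theta> v i \<bullet> c \<theta> w i) = sin \<theta> * cos \<theta> * (\<Sum>i\<in>J. b v i \<bullet> b w i) - sin \<theta> * cos \<theta> * (\<Sum>i\<in>J. a v i \<bullet> a w i)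
        + cos \<theta> * cos \<theta> * (\<Sum>i\<in>J. a w i \<bullet> b v i) - sin \<theta> * sin \<theta> * (\<Sum>i\<in>J. a v i \<bullet> b w i)"
      unfolding sum_distrib_left sum.distrib[symmetric] sum_subtractf[symmetric]
      by (intro sum.cong refl)
        (simp add: c_def c'_def inner_diff_left inner_add_right inner_commute algebra_simps)
    then show ?thesis using cross that by (simp add: algebra_simps)
  qed
  have \<psi>'_le: "\<psi>' \<theta> \<le> 0" if "0 \<le> \<theta>" "\<theta> \<le> pi / 2" for \<theta>
  proof -
    have sc: "0 \<le> sin \<theta> * cos \<theta>"
      using that by (intro mult_nonneg_nonneg sin_ge_zero cos_ge_zero) auto
    have term_nonneg: "0 \<le> (\<integral>g. Z' \<theta> v g * (y \<theta> v g * f \<theta> g) \<partial>?M)" if v: "v \<in> V" for v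
    proof -
      define P where "P = (\<integral>g. y \<theta> v g * f \<theta> g \<partial>?M)"
      define Q where "Q w = (\<integral>g. y \<theta> v g * y \<theta> w g * f \<theta> g \<partial>?M)" for w
      have ii: "integrable ?M (\<lambda>g. (c' \<theta> v i \<bullet> g i) * (y \<theta> v g * f \<theta> g))" if "i \<in> J" for i
      proof (rule Bochner_Integration.integrable_bound)
        show "integrable ?M (\<lambda>g. cmod (c' \<theta> v i) * cmod (g i) * 1)"
          by (intro integrable_mult_left integrable_mult_right integrable_PiM_cgauss_component that integrable_cgauss_cmod)
        show "AE g in ?M. norm ((c' \<theta> v i \<bullet> g i) * (y \<theta> v g * f \<theta> g)) \<le> norm (cmod (c' \<theta> v i) * cmod (g i) * 1)"
          unfolding norm_mult[of "c' \<theta> v i \<bullet> _"] norm_mult[of _ 1] using yf[OF v]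
          by (intro always_eventually allI mult_mono) (auto simp: Cauchy_Schwarz_ineq2)
      qed (use that in measurable)
      have "(\<integral>g. Z' \<theta> v g * (y \<theta> v g * f \<theta> g) \<partial>?M)
          = (\<Sum>i\<in>J. \<integral>g. (c' \<theta> v i \<bullet> g i) * (y \<theta> v g * f \<theta> g) \<partial>?M)"
        unfolding Z'_def sum_distrib_right using ii by (rule Bochner_Integration.integral_sum)
      also have "\<dots> = (\<Sum>i\<in>J. \<beta> / 2 * ((c' \<theta> v i \<bullet> c \<theta> v i) * P - (\<Sum>w\<in>V. (c' \<theta> v i \<bullet> c \<theta> w i) * Q w)))"
        unfolding P_def Q_def by (intro sum.cong refl parts v)
      also have "\<dots> = \<beta> / 2 * ((\<Sum>i\<in>J. c' \<theta> v i \<bullet> c \<theta> v i) * P - (\<Sum>w\<in>V. (\<Sum>i\<in>J. c' \<theta> v i \<bullet> c \<theta> w i) * Q w))"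
        unfolding sum_distrib_left[symmetric] sum_subtractf sum_distrib_right
        by (subst sum.swap) simp
      also have "\<dots> = \<beta> / 2 * (\<Sum>w\<in>V. - (\<Sum>i\<in>J. c' \<theta> v i \<bullet> c \<theta> w i) * Q w)"
        using cov'[OF v v] var[OF v] by (simp add: sum_negf)
      also have "0 \<le> \<dots>"
      proof (intro mult_nonneg_nonneg sum_nonneg)
        fix w assume w: "w \<in> V"
        show "0 \<le> - (\<Sum>i\<in>J. c' \<theta> v i \<bullet> c \<theta> w i)"
          unfolding cov'[OF v w] using mult_nonneg_nonpos[OF sc] cov[OF v w] by simp
        show "0 \<le> Q w" unfolding Q_def using yyf[OF v w] by (intro integral_nonneg_AE) auto
      qed (use \<open>\<beta> > 0\<close> in auto)
      finally show ?thesis .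
    qed
    have "integrable ?M (\<lambda>g. Z' \<theta> v g * (y \<theta> v g * f \<theta> g))" if "v \<in> V" for v
    proof (rule Bochner_Integration.integrable_bound)
      show "integrable ?M (\<lambda>g. (\<Sum>i\<in>J. (cmod (a v i) + cmod (b v i)) * cmod (g i)) * 1)"
        by (intro integrable_mult_left integrable_mult_right Bochner_Integration.integrable_sum integrable_PiM_cgauss_component integrable_cgauss_cmod)
      show "AE g in ?M. norm (Z' \<theta> v g * (y \<theta> v g * f \<theta> g)) \<le> norm ((\<Sum>i\<in>J. (cmod (a v i) + cmod (b v i)) * cmod (g i)) * 1)"
        unfolding norm_mult[of "Z' \<theta> v _"] norm_mult[of _ 1] using yf[OF that]
        by (intro always_eventually allI mult_mono) (auto intro: order_trans[OF Z'_bound abs_ge_self])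
    qed measurable
    then have "\<psi>' \<theta> = - \<beta> * (\<Sum>v\<in>V. \<integral>g. Z' \<theta> v g * (y \<theta> v g * f \<theta> g) \<partial>?M)"
      unfolding \<psi>'_def by (simp add: Bochner_Integration.integral_sum)
    also have "\<dots> \<le> 0"
      using \<open>\<beta> > 0\<close> term_nonneg by (simp add: sum_nonneg)
    finally show ?thesis .
  qed
  \<comment> \<open>The endpoints are the two processes: \<theta> = 0 gives the coefficients
    \<open>a\<close>, \<theta> = pi/2 gives \<open>b\<close>.\<close>
  have "(\<integral>g. f (pi / 2) g \<partial>?M) \<le> (\<integral>g. f 0 g \<partial>?M)"
    by (rule DERIV_nonpos_imp_nonincreasing) (use d\<psi> \<psi>'_le in auto)
  then show ?thesis
    by (simp add: f_def y_def Z_def c_def)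
qed

section \<open>Quadratic forms of the random matrix\<close>

definition sqnorm :: "nat \<Rightarrow> (nat \<times> nat \<Rightarrow> complex) \<Rightarrow> real" where
  "sqnorm d v = (\<Sum>k\<in>Idx d. (cmod (v k))\<^sup>2)"

text \<open>Coefficients that make <v, G v> a real linear functional of the independent, not yet
  symmetrised entries. Symmetrising turns each entry into sqrt 2 times a real part, which is the
  factor in front; the diagonal correction removes the trace.\<close>

definition qcoef :: "nat \<Rightarrow> (nat \<times> nat \<Rightarrow> complex) \<Rightarrow> (nat \<times> nat) \<times> (nat \<times> nat) \<Rightarrow> complex" where
  "qcoef d v p = sqrt 2 *\<^sub>R (v (fst p) * cnj (v (snd p))
     - (if fst p = snd p then complex_of_real (sqnorm d v / (real d)\<^sup>2) else 0))"

definition qlin :: "nat \<Rightarrow> (nat \<times> nat \<Rightarrow> complex) \<Rightarrow> ((nat \<times> nat) \<times> (nat \<times> nat) \<Rightarrow> complex) \<Rightarrow> real" where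
  "qlin d v g = (\<Sum>p\<in>Idx d \<times> Idx d. qcoef d v p \<bullet> g p)"

lemma finite_Idx [simp]: "finite (Idx d)"
  and card_Idx: "card (Idx d) = d\<^sup>2"
  by (simp_all add: Idx_def power2_eq_square)

lemma inner_complex_eq_Re: "(x :: complex) \<bullet> y = Re (cnj x * y)"
  by (simp add: inner_complex_def)

lemma complex_of_sqnorm: "complex_of_real (sqnorm d v) = (\<Sum>k\<in>Idx d. cnj (v k) * v k)"
  unfolding sqnorm_def of_real_sum by (intro sum.cong refl) (metis complex_norm_square mult.commute of_real_power)

text \<open>Twice the Hilbert-Schmidt inner product of the traceless parts of v v* and w w*.
  Projecting off the identity subtracts the product of the traces divided by the dimension
  d^2.\<close>

lemma sum_qcoef_inner:
  assumes "d \<ge> 1"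
  shows "(\<Sum>p\<in>Idx d \<times> Idx d. qcoef d v p \<bullet> qcoef d w p)
     = 2 * ((cmod (\<Sum>i\<in>Idx d. cnj (v i) * w i))\<^sup>2 - sqnorm d v * sqnorm d w / (real d)\<^sup>2)"
proof -
  let ?I = "Idx d" and ?s = "\<Sum>i\<in>Idx d. cnj (v i) * w i"
  let ?n = "complex_of_real ((real d)\<^sup>2)"
  define N where "N = complex_of_real (sqnorm d v / (real d)\<^sup>2)"
  define M where "M = complex_of_real (sqnorm d w / (real d)\<^sup>2)"
  have n: "?n * N = (\<Sum>i\<in>?I. cnj (v i) * v i)" "?n * M = (\<Sum>i\<in>?I. cnj (w i) * w i)"
    using assms unfolding complex_of_sqnorm[symmetric] by (simp_all add: N_def M_def)
  have cN: "cnj N = N" by (simp add: N_def)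
  have inner2: "(sqrt 2 *\<^sub>R x) \<bullet> (sqrt 2 *\<^sub>R y) = 2 * Re (cnj x * y)" for x y :: complex
    unfolding inner_complex_eq_Re[symmetric] by (simp add: mult.assoc[symmetric])
  have "(\<Sum>p\<in>?I \<times> ?I. qcoef d v p \<bullet> qcoef d w p) = 2 * Re (\<Sum>p\<in>?I \<times> ?I.
      cnj (v (fst p) * cnj (v (snd p)) - (if fst p = snd p then N else 0))
        * (w (fst p) * cnj (w (snd p)) - (if fst p = snd p then M else 0)))"
    unfolding Re_sum sum_distrib_left qcoef_def N_def[symmetric] M_def[symmetric]
    by (intro sum.cong refl) (simp only: inner2)
  also have "(\<Sum>p\<in>?I \<times> ?I.
      cnj (v (fst p) * cnj (v (snd p)) - (if fst p = snd p then N else 0))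
        * (w (fst p) * cnj (w (snd p)) - (if fst p = snd p then M else 0)))
    = (\<Sum>i\<in>?I. \<Sum>j\<in>?I. (cnj (v i) * w i) * (v j * cnj (w j))
         - (if i = j then M * (cnj (v i) * v i) + N * (cnj (w i) * w i) - N * M else 0))"
    unfolding sum.cartesian_product by (intro sum.cong refl) (auto simp: cN algebra_simps)
  also have "\<dots> = ?s * cnj ?s - (M * (\<Sum>i\<in>?I. cnj (v i) * v i) + N * (\<Sum>i\<in>?I. cnj (w i) * w i) - ?n * (N * M))"
    by (simp add: sum_subtractf sum.delta sum.distrib sum_distrib_left[symmetric] sum_distrib_right[symmetric] card_Idx)
  also have "\<dots> = ?s * cnj ?s - ?n * N * M"
    unfolding n[symmetric] by (simp add: algebra_simps)
  also have "\<dots> = complex_of_real ((cmod ?s)\<^sup>2 - sqnorm d v * sqnorm d w / (real d)\<^sup>2)"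
    using assms by (simp only: complex_norm_square[symmetric] of_real_diff of_real_power)
      (simp add: N_def M_def power2_eq_square)
  finally show ?thesis by simp
qed

lemma sum_diag_Times:
  assumes "finite A"
  shows "(\<Sum>p\<in>A \<times> A. if fst p = snd p then h (fst p) else 0) = (\<Sum>i\<in>A. h i)"
proof -
  have "(\<Sum>p\<in>A \<times> A. if fst p = snd p then h (fst p) else 0) = (\<Sum>i\<in>A. \<Sum>j\<in>A. if i = j then h i else 0)"
    unfolding sum.cartesian_product by (intro sum.cong refl) auto
  then show ?thesis using assms by (simp add: sum.delta)
qed

lemma quadratic_form_Gtz:
  assumes "d \<ge> 1"
  shows "(\<Sum>i\<in>Idx d. \<Sum>j\<in>Idx d. cnj (v i) * Gtz d g i j * v j) = complex_of_real (qlin d v g)"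
proof -
  let ?I = "Idx d"
  have add_cnj_sqrt2: "(z + cnj z) / complex_of_real (sqrt 2) = complex_of_real (sqrt 2 * Re z)" for z
  proof -
    have "(z + cnj z) / complex_of_real (sqrt 2) = complex_of_real (2 * Re z / sqrt 2)"
      by (simp add: complex_add_cnj)
    also have "2 * Re z / sqrt 2 = sqrt 2 * Re z"
      by (simp add: real_divide_square_eq field_simps)
    finally show ?thesis .
  qed
  \<comment> \<open>\<open>S\<close> is the form of the raw matrix; its conjugate is the form of the
    adjoint, so the symmetrised form is (S + cnj S) / sqrt 2.\<close>
  define S where "S = (\<Sum>i\<in>?I. \<Sum>j\<in>?I. cnj (v i) * g (i, j) * v j)"
  define T where "T = (\<Sum>k\<in>?I. g (k, k))"
  have cS: "cnj S = (\<Sum>i\<in>?I. \<Sum>j\<in>?I. cnj (v i) * cnj (g (j, i)) * v j)"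
    unfolding S_def by (subst sum.swap) (simp add: mult_ac)
  have tr: "(\<Sum>k\<in>?I. Gprime g k k) = complex_of_real (sqrt 2 * Re T)"
    unfolding Gprime_def add_cnj_sqrt2 T_def by (simp add: sum_distrib_left)
  have "(\<Sum>i\<in>?I. \<Sum>j\<in>?I. cnj (v i) * Gtz d g i j * v j)
    = (\<Sum>i\<in>?I. \<Sum>j\<in>?I. (cnj (v i) * g (i, j) * v j + cnj (v i) * cnj (g (j, i)) * v j) / complex_of_real (sqrt 2)
        - (if i = j then (cnj (v i) * v i) * (complex_of_real (sqrt 2 * Re T) / of_nat (d\<^sup>2)) else 0))"
    unfolding Gtz_def tr unfolding Gprime_def
    by (intro sum.cong refl) (simp add: algebra_simps add_divide_distrib)
  also have "\<dots> = (S + cnj S) / complex_of_real (sqrt 2)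
      - complex_of_real (sqnorm d v) * (complex_of_real (sqrt 2 * Re T) / of_nat (d\<^sup>2))"
    unfolding cS unfolding S_def complex_of_sqnorm
    by (simp add: sum_subtractf sum.delta sum_divide_distrib[symmetric] sum.distrib[symmetric] sum_distrib_right)
  also have "\<dots> = complex_of_real (sqrt 2 * (Re S - sqnorm d v / (real d)\<^sup>2 * Re T))"
    unfolding add_cnj_sqrt2 by (simp add: algebra_simps)
  also have "sqrt 2 * (Re S - sqnorm d v / (real d)\<^sup>2 * Re T) = qlin d v g"
  proof -
    have "qlin d v g = (\<Sum>p\<in>?I \<times> ?I. sqrt 2 * (Re (cnj (v (fst p)) * g p * v (snd p))
        - (if fst p = snd p then sqnorm d v / (real d)\<^sup>2 * Re (g (fst p, fst p)) else 0)))"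
      unfolding qlin_def qcoef_def
      by (intro sum.cong refl)
        (auto simp: inner_diff_left inner_complex_eq_Re algebra_simps)
    also have "\<dots> = sqrt 2 * (Re S - sqnorm d v / (real d)\<^sup>2 * Re T)"
      unfolding sum_distrib_left[symmetric] sum_subtractf
      by (subst sum_diag_Times)
        (simp_all add: S_def T_def sum.cartesian_product case_prod_beta sum_distrib_left)
    finally show ?thesis by simp
  qed
  finally show ?thesis .
qed

text \<open>The form of \<open>rho\<close> is real for every vector, so the condition on
  \<open>Im\<close> is automatic, and the positive factor 1/d^2 does not affect the sign.\<close>

lemma psd_rho_iff:
  assumes "d \<ge> 1"
  shows "psd (Idx d) (rho \<alpha> d g) \<longleftrightarrow> (\<forall>v. 0 \<le> sqnorm d v + \<alpha> / real d * qlin d v g)"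
proof -
  let ?I = "Idx d"
  have q: "(\<Sum>i\<in>?I. \<Sum>j\<in>?I. cnj (v i) * rho \<alpha> d g i j * v j)
    = complex_of_real ((sqnorm d v + \<alpha> / real d * qlin d v g) / (real d)\<^sup>2)" for v
  proof -
    have "(\<Sum>i\<in>?I. \<Sum>j\<in>?I. cnj (v i) * rho \<alpha> d g i j * v j)
      = (\<Sum>i\<in>?I. \<Sum>j\<in>?I. (1 / of_nat (d\<^sup>2)) * ((if i = j then cnj (v i) * v i else 0)
          + complex_of_real (\<alpha> / real d) * (cnj (v i) * Gtz d g i j * v j)))"
      unfolding rho_def by (intro sum.cong refl) (simp add: algebra_simps)
    also have "\<dots> = (1 / of_nat (d\<^sup>2)) * (complex_of_real (sqnorm d v)
          + complex_of_real (\<alpha> / real d) * (\<Sum>i\<in>?I. \<Sum>j\<in>?I. cnj (v i) * Gtz d g i j * v j))"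
      unfolding sum_distrib_left[symmetric] sum.distrib complex_of_sqnorm by (simp add: sum.delta)
    also have "\<dots> = complex_of_real ((sqnorm d v + \<alpha> / real d * qlin d v g) / (real d)\<^sup>2)"
      unfolding quadratic_form_Gtz[OF assms] by simp
    finally show ?thesis .
  qed
  show ?thesis
    unfolding psd_def q Let_def using assms by (simp add: zero_le_divide_iff)
qed

lemma qlin_scale: "qlin d (\<lambda>i. complex_of_real r * v i) g = r\<^sup>2 * qlin d v g"
proof -
  have "sqnorm d (\<lambda>i. complex_of_real r * v i) = r\<^sup>2 * sqnorm d v"
    by (simp add: sqnorm_def norm_mult power_mult_distrib sum_distrib_left)
  then have "qcoef d (\<lambda>i. complex_of_real r * v i) p = r\<^sup>2 *\<^sub>R qcoef d v p" for p
    by (simp add: qcoef_def scaleR_conv_of_real power2_eq_square algebra_simps)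
  then show ?thesis by (simp add: qlin_def sum_distrib_left)
qed

text \<open>The permutation of entry positions commutes with exchanging row and column, hence with
  Hermitian symmetrisation, and it fixes diagonal positions, hence the trace. So it can be carried
  out on the raw entries before \<open>rho\<close> is formed.\<close>

lemma ptrans_rho:
  "ptrans (rho \<alpha> d g) = rho \<alpha> d (\<lambda>p. g ((fst (fst p), snd (snd p)), (fst (snd p), snd (fst p))))"
  by (intro ext) (auto simp: ptrans_def rho_def Gtz_def Gprime_def prod_eq_iff)

section \<open>Tail bounds\<close>

lemma space_gue_space [simp]: "space (gue_space d) = Idx d \<times> Idx d \<rightarrow>\<^sub>E UNIV"
  by (simp add: gue_space_def space_PiM)

lemma prob_space_gue_space: "prob_space (gue_space d)"
  unfolding gue_space_def by (intro prob_space_PiM prob_space_cgauss)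

lemma measurable_PiM_cgauss_component:
  "p \<in> J \<Longrightarrow> (\<lambda>g. g p) \<in> borel_measurable (\<Pi>\<^sub>M _\<in>J. cgauss)"
  using measurable_component_singleton[of p J "\<lambda>_. cgauss"] by simp

lemma qlin_measurable:
  assumes "Idx d \<times> Idx d \<subseteq> J"
  shows "qlin d v \<in> borel_measurable (\<Pi>\<^sub>M _\<in>J. cgauss)"
  unfolding qlin_def
  by (intro borel_measurable_sum borel_measurable_inner borel_measurable_const measurable_PiM_cgauss_component) (use assms in auto)

lemma qlin_cong: "(\<And>p. p \<in> Idx d \<times> Idx d \<Longrightarrow> g p = h p) \<Longrightarrow> qlin d v g = qlin d v h"
  unfolding qlin_def by (intro sum.cong) auto

section \<open>The two Gaussian processes on one product space\<close>

text \<open>Fresh coordinates for the comparison live in the same index type: \<open>(i, (d, 0))\<close> carries the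
  component \<open>h i\<close> of the Gaussian vector and \<open>((d, 0), (d, 0))\<close> the noise \<open>\<xi>\<close>.\<close>

definition ext_idx :: "nat \<Rightarrow> ((nat \<times> nat) \<times> (nat \<times> nat)) set" where
  "ext_idx d = insert ((d, 0), (d, 0)) (Idx d \<times> Idx d \<union> (\<lambda>i. (i, (d, 0))) ` Idx d)"

lemma finite_ext_idx [simp]: "finite (ext_idx d)"
  by (simp add: ext_idx_def)

lemma not_in_Idx [simp]: "(d, k) \<notin> Idx d"
  by (simp add: Idx_def)

lemma sum_ext_idx:
  "(\<Sum>p\<in>ext_idx d. h p) = (\<Sum>p\<in>Idx d \<times> Idx d. h p) + (\<Sum>i\<in>Idx d. h (i, (d, 0))) + h ((d, 0), (d, 0))"
  for h :: "_ \<Rightarrow> real"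
proof -
  have "(\<Sum>p\<in>ext_idx d. h p)
      = h ((d, 0), (d, 0)) + (\<Sum>p\<in>Idx d \<times> Idx d \<union> (\<lambda>i. (i, (d, 0))) ` Idx d. h p)"
    unfolding ext_idx_def by (rule sum.insert) auto
  also have "(\<Sum>p\<in>Idx d \<times> Idx d \<union> (\<lambda>i. (i, (d, 0))) ` Idx d. h p)
      = (\<Sum>p\<in>Idx d \<times> Idx d. h p) + (\<Sum>p\<in>(\<lambda>i. (i, (d, 0))) ` Idx d. h p)"
    by (rule sum.union_disjoint) auto
  also have "(\<Sum>p\<in>(\<lambda>i. (i, (d, 0))) ` Idx d. h p) = (\<Sum>i\<in>Idx d. h (i, (d, 0)))"
    by (subst sum.reindex) (auto simp: inj_on_def)
  finally show ?thesis by simp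
qed

text \<open>Coefficient vectors of \<open>X\<^sub>v\<close> (with noise \<open>\<epsilon> \<xi>\<close>, \<open>\<epsilon> = \<plusminus>1\<close>) and of \<open>Y\<^sub>v\<close>. Since
  \<open>cgauss\<close> has real and imaginary parts of variance 1/2, covariances are half the inner
  products of the coefficients.\<close>

definition xcoef :: "nat \<Rightarrow> real \<Rightarrow> (nat \<times> nat \<Rightarrow> complex) \<Rightarrow> (nat \<times> nat) \<times> (nat \<times> nat) \<Rightarrow> complex" where
  "xcoef d \<epsilon> v p = (if p \<in> Idx d \<times> Idx d then - qcoef d v p
     else if p = ((d, 0), (d, 0)) then complex_of_real (\<epsilon> * sqrt (2 * (1 + 1 / (real d)\<^sup>2))) else 0)"

definition ycoef :: "nat \<Rightarrow> (nat \<times> nat \<Rightarrow> complex) \<Rightarrow> (nat \<times> nat) \<times> (nat \<times> nat) \<Rightarrow> complex" where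
  "ycoef d v p = (if fst p \<in> Idx d \<and> snd p = (d, 0) then 2 * v (fst p) else 0)"

lemma sum_xcoef:
  "(\<Sum>p\<in>ext_idx d. xcoef d \<epsilon> v p \<bullet> g p)
    = - qlin d v g + \<epsilon> * (sqrt (2 * (1 + 1 / (real d)\<^sup>2)) * Re (g ((d, 0), (d, 0))))"
proof -
  have "(\<Sum>p\<in>Idx d \<times> Idx d. xcoef d \<epsilon> v p \<bullet> g p) = - qlin d v g"
    unfolding qlin_def sum_negf[symmetric] by (intro sum.cong refl) (auto simp: xcoef_def)
  moreover have "xcoef d \<epsilon> v (i, (d, 0)) = 0" if "i \<in> Idx d" for i
    using that by (auto simp: xcoef_def)
  ultimately show ?thesis
    unfolding sum_ext_idx by (simp add: xcoef_def inner_complex_def)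
qed

lemma sum_ycoef: "(\<Sum>p\<in>ext_idx d. ycoef d v p \<bullet> g p) = 2 * (\<Sum>i\<in>Idx d. v i \<bullet> g (i, (d, 0)))"
proof -
  have "(\<Sum>p\<in>Idx d \<times> Idx d. ycoef d v p \<bullet> g p) = 0"
    by (intro sum.neutral) (auto simp: ycoef_def)
  then show ?thesis
    unfolding sum_ext_idx by (simp add: ycoef_def sum_distrib_left inner_complex_def algebra_simps)
qed

lemma sum_xcoef_ycoef: "(\<Sum>p\<in>ext_idx d. xcoef d \<epsilon> v p \<bullet> ycoef d w p) = 0"
  by (intro sum.neutral) (auto simp: xcoef_def ycoef_def ext_idx_def)

lemma sum_ycoef_ycoef:
  "(\<Sum>p\<in>ext_idx d. ycoef d v p \<bullet> ycoef d w p) = 4 * Re (\<Sum>i\<in>Idx d. cnj (v i) * w i)"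
  unfolding sum_ycoef by (simp add: ycoef_def sum_distrib_left inner_complex_def algebra_simps)

text \<open>The noise contributes 2 + 2/d^2 to every pair: the part 2/d^2 cancels the deficit caused
  by removing the trace, and the part 2 lifts the value at v = w to 4, the one for
  \<open>ycoef\<close>.\<close>

lemma sum_xcoef_xcoef:
  assumes "d \<ge> 1" "\<epsilon>\<^sup>2 = 1" "sqnorm d v = 1" "sqnorm d w = 1"
  shows "(\<Sum>p\<in>ext_idx d. xcoef d \<epsilon> v p \<bullet> xcoef d \<epsilon> w p)
    = 2 * (cmod (\<Sum>i\<in>Idx d. cnj (v i) * w i))\<^sup>2 + 2"
proof -
  have "- qlin d v (xcoef d \<epsilon> w) = (\<Sum>p\<in>Idx d \<times> Idx d. qcoef d v p \<bullet> qcoef d w p)"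
    unfolding qlin_def sum_negf[symmetric] by (intro sum.cong refl) (auto simp: xcoef_def)
  moreover have "\<epsilon> * (sqrt (2 * (1 + 1 / (real d)\<^sup>2)) * Re (xcoef d \<epsilon> w ((d, 0), (d, 0)))) = \<epsilon>\<^sup>2 * (sqrt (2 * (1 + 1 / (real d)\<^sup>2)))\<^sup>2"
    by (simp add: xcoef_def power2_eq_square)
  moreover have "(sqrt (2 * (1 + 1 / (real d)\<^sup>2)))\<^sup>2 = 2 * (1 + 1 / (real d)\<^sup>2)"
    by (rule real_sqrt_pow2) simp
  ultimately show ?thesis
    unfolding sum_xcoef using sum_qcoef_inner[OF assms(1), of v w] assms by (simp add: algebra_simps)
qed

section \<open>From the Gaussian vector to tails of the quadratic form\<close>

lemma exp_sum_square_integral: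
  assumes "\<kappa> < 1"
  shows "integrable (\<Pi>\<^sub>M _\<in>ext_idx d. cgauss) (\<lambda>g. exp (\<kappa> * (\<Sum>i\<in>Idx d. (cmod (g (i, (d, 0))))\<^sup>2)))" (is ?int)
    and "(\<integral>g. exp (\<kappa> * (\<Sum>i\<in>Idx d. (cmod (g (i, (d, 0))))\<^sup>2)) \<partial>(\<Pi>\<^sub>M _\<in>ext_idx d. cgauss)) = (1 / (1 - \<kappa>)) ^ (d\<^sup>2)" (is ?val)
proof -
  let ?H = "(\<lambda>i. (i, (d, 0::nat))) ` Idx d"
  \<comment> \<open>Coordinates other than those of the vector h get the factor 1, so that the
    exponential becomes a product over the whole index set.\<close>
  let ?h = "\<lambda>p z. if p \<in> ?H then exp (\<kappa> * (cmod z)\<^sup>2) else 1"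
  interpret product_prob_space "\<lambda>_::(nat \<times> nat) \<times> (nat \<times> nat). cgauss" "ext_idx d"
    by (rule product_prob_space_cgauss)
  have sub: "?H \<subseteq> ext_idx d" by (auto simp: ext_idx_def)
  have inj: "inj_on (\<lambda>i. (i, (d, 0::nat))) (Idx d)" by (auto simp: inj_on_def)
  have eq: "exp (\<kappa> * (\<Sum>i\<in>Idx d. (cmod (g (i, (d, 0))))\<^sup>2)) = (\<Prod>p\<in>ext_idx d. ?h p (g p))" for g
  proof -
    have "(\<Prod>p\<in>ext_idx d. ?h p (g p)) = (\<Prod>p\<in>?H. exp (\<kappa> * (cmod (g p))\<^sup>2))"
      using sub by (subst prod.inter_restrict[symmetric]) (auto simp: Int_absorb1)
    then show ?thesis
      by (simp add: prod.reindex[OF inj] exp_sum sum_distrib_left)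
  qed
  have i: "integrable cgauss (?h p)" for p
    using cgauss_exp_square[OF assms] by (cases "p \<in> ?H") (auto simp only: has_bochner_integral_iff if_True if_False cgauss.integrable_const)
  show ?int unfolding eq by (rule product_integrable_prod) (auto intro: i)
  have "(\<integral>g. (\<Prod>p\<in>ext_idx d. ?h p (g p)) \<partial>(\<Pi>\<^sub>M _\<in>ext_idx d. cgauss)) = (\<Prod>p\<in>ext_idx d. integral\<^sup>L cgauss (?h p))"
    by (rule product_integral_prod) (auto intro: i)
  also have "\<dots> = (\<Prod>p\<in>ext_idx d. if p \<in> ?H then 1 / (1 - \<kappa>) else 1)"
    using cgauss_exp_square[OF assms] by (intro prod.cong refl) (auto simp: has_bochner_integral_iff cgauss.prob_space[unfolded space_cgauss])
  also have "\<dots> = (\<Prod>p\<in>?H. 1 / (1 - \<kappa>))"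
    using sub by (subst prod.inter_restrict[symmetric]) (auto simp: Int_absorb1)
  also have "\<dots> = (1 / (1 - \<kappa>)) ^ (d\<^sup>2)"
    by (simp add: card_image[OF inj] card_Idx)
  finally show ?val unfolding eq .
qed

lemma sum_inner_le:
  assumes "sqnorm d v = 1"
  shows "(\<Sum>i\<in>Idx d. v i \<bullet> h i) \<le> sqrt (\<Sum>i\<in>Idx d. (cmod (h i))\<^sup>2)"
proof -
  have "(\<Sum>i\<in>Idx d. v i \<bullet> h i) \<le> (\<Sum>i\<in>Idx d. cmod (v i) * cmod (h i))"
    by (intro sum_mono norm_cauchy_schwarz)
  also have "\<dots> \<le> L2_set (\<lambda>i. cmod (v i)) (Idx d) * L2_set (\<lambda>i. cmod (h i)) (Idx d)"
    using L2_set_mult_ineq[of "\<lambda>i. cmod (v i)" "\<lambda>i. cmod (h i)" "Idx d"] by simp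
  finally show ?thesis
    using assms by (simp add: L2_set_def sqnorm_def)
qed

text \<open>The bound is free of the number of vectors. The comparison is made at level t, while |h|
  is cut off at s/2; the gap s < t makes the only term containing \<open>card V\<close> vanish as
  \<beta> tends to infinity.\<close>

lemma noisy_tail:
  assumes d: "d \<ge> 1" and V: "finite V" "\<And>v. v \<in> V \<Longrightarrow> sqnorm d v = 1"
    and \<epsilon>: "\<epsilon>\<^sup>2 = 1" and \<kappa>: "0 \<le> \<kappa>" "\<kappa> < 1" and s: "0 \<le> s" "s < t"
  shows "measure (\<Pi>\<^sub>M _\<in>ext_idx d. cgauss)
      {g \<in> space (\<Pi>\<^sub>M _\<in>ext_idx d. cgauss). \<exists>v\<in>V. t \<le> (\<Sum>p\<in>ext_idx d. xcoef d \<epsilon> v p \<bullet> g p)}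
    \<le> 2 * (exp (- \<kappa> * s\<^sup>2 / 4) * (1 / (1 - \<kappa>)) ^ (d\<^sup>2))"
proof -
  let ?M = "\<Pi>\<^sub>M _\<in>ext_idx d. cgauss"
  interpret product_prob_space "\<lambda>_::(nat \<times> nat) \<times> (nat \<times> nat). cgauss" "ext_idx d"
    by (rule product_prob_space_cgauss)
  define X where "X v g = (\<Sum>p\<in>ext_idx d. xcoef d \<epsilon> v p \<bullet> g p)" for v g
  define Y where "Y v g = (\<Sum>p\<in>ext_idx d. ycoef d v p \<bullet> g p)" for v g
  define E where "E = {g \<in> space ?M. \<exists>v\<in>V. t \<le> X v g}"
  define h2 where "h2 g = (\<Sum>i\<in>Idx d. (cmod (g (i, (d, 0::nat))))\<^sup>2)" for g :: "(nat \<times> nat) \<times> (nat \<times> nat) \<Rightarrow> complex"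
  define R where "R = exp (- \<kappa> * s\<^sup>2 / 4) * (1 / (1 - \<kappa>)) ^ (d\<^sup>2)"
  have [measurable]: "X v \<in> borel_measurable ?M" "Y v \<in> borel_measurable ?M" for v
    unfolding X_def Y_def
    by (auto intro!: borel_measurable_sum borel_measurable_inner measurable_PiM_cgauss_component)
  have E_sets: "E \<in> sets ?M"
    unfolding E_def using V(1) by measurable
  \<comment> \<open>On \<open>E\<close> some summand of \<open>?SX\<close> is at least 1, so 1 -
    exp(-\<open>?SX\<close>) is at least 1 - exp(-1) there: a Markov-type bound in which the smooth
    functional replaces the indicator.\<close>
  have bound: "measure ?M E * (1 - exp (-1)) \<le> R + real (card V) * exp (\<beta> * (s - t))" if \<beta>: "\<beta> > 0" for \<beta>
  proof -
    let ?SX = "\<lambda>g. \<Sum>v\<in>V. exp (\<beta> * (X v g - t))" and ?SY = "\<lambda>g. \<Sum>v\<in>V. exp (\<beta> * (Y v g - t))"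
    have int: "integrable ?M (\<lambda>g. exp (- ?SX g))" "integrable ?M (\<lambda>g. exp (- ?SY g))"
      by (rule integrable_const_bound[where B = 1]; auto intro!: sum_nonneg)+
    have "measure ?M E * (1 - exp (-1)) = (\<integral>g. indicator E g * (1 - exp (-1)) \<partial>?M)"
      using E_sets by (simp add: Int_absorb2 sets.sets_into_space)
    also have "\<dots> \<le> (\<integral>g. 1 - exp (- ?SX g) \<partial>?M)"
    proof (rule integral_mono)
      show "integrable ?M (\<lambda>g. indicator E g * (1 - exp (-1)) :: real)"
        using E_sets by (intro integrable_mult_left) (auto simp: integrable_indicator_iff emeasure_eq_measure)
      show "integrable ?M (\<lambda>g. 1 - exp (- ?SX g))" using int by simp
      fix g
      show "indicator E g * (1 - exp (-1)) \<le> 1 - exp (- ?SX g)"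
      proof (cases "g \<in> E")
        case True
        then obtain v where v: "v \<in> V" "t \<le> X v g" by (auto simp: E_def)
        have "1 \<le> exp (\<beta> * (X v g - t))" using v \<beta> by simp
        also have "\<dots> \<le> ?SX g" by (rule member_le_sum) (use v V in auto)
        finally show ?thesis using True by simp
      qed (simp add: sum_nonneg)
    qed
    also have "\<dots> \<le> (\<integral>g. 1 - exp (- ?SY g) \<partial>?M)"
    proof -
      have "(\<integral>g. exp (- ?SY g) \<partial>?M) \<le> (\<integral>g. exp (- ?SX g) \<partial>?M)"
        unfolding X_def Y_def
      proof (rule slepian_exp[OF finite_ext_idx V(1) _ _ sum_xcoef_ycoef \<beta>])
        fix v assume v: "v \<in> V"
        have "(\<Sum>i\<in>Idx d. cnj (v i) * v i) = 1"
          using V(2)[OF v] complex_of_sqnorm[of d v] by simp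
        then show "(\<Sum>p\<in>ext_idx d. xcoef d \<epsilon> v p \<bullet> xcoef d \<epsilon> v p) = (\<Sum>p\<in>ext_idx d. ycoef d v p \<bullet> ycoef d v p)"
          using sum_xcoef_xcoef[OF d \<epsilon> V(2)[OF v] V(2)[OF v]] by (simp only: sum_ycoef_ycoef) simp
      next
        fix v w assume v: "v \<in> V" "w \<in> V"
        let ?s = "\<Sum>i\<in>Idx d. cnj (v i) * w i"
        have "4 * Re ?s \<le> 4 * cmod ?s" using complex_Re_le_cmod[of ?s] by linarith
        also have "\<dots> \<le> 2 * (cmod ?s)\<^sup>2 + 2"
          using zero_le_power2[of "cmod ?s - 1"] by (simp add: power2_eq_square algebra_simps)
        finally show "(\<Sum>p\<in>ext_idx d. ycoef d v p \<bullet> ycoef d w p) \<le> (\<Sum>p\<in>ext_idx d. xcoef d \<epsilon> v p \<bullet> xcoef d \<epsilon> w p)"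
          unfolding sum_ycoef_ycoef sum_xcoef_xcoef[OF d \<epsilon> V(2)[OF v(1)] V(2)[OF v(2)]] .
      qed
      then show ?thesis using int by (simp add: P.prob_space)
    qed
    also have "\<dots> \<le> (\<integral>g. exp (- \<kappa> * s\<^sup>2 / 4) * exp (\<kappa> * h2 g) + real (card V) * exp (\<beta> * (s - t)) \<partial>?M)"
    proof (rule integral_mono)
      show "integrable ?M (\<lambda>g. 1 - exp (- ?SY g))" using int by simp
      show "integrable ?M (\<lambda>g. exp (- \<kappa> * s\<^sup>2 / 4) * exp (\<kappa> * h2 g) + real (card V) * exp (\<beta> * (s - t)))"
        using exp_sum_square_integral(1)[OF \<kappa>(2), of d] by (simp add: h2_def)
      fix g
      \<comment> \<open>If 2|h| is at most s, Cauchy-Schwarz keeps every Y_v below s, and 1 -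
        exp(-x) \<le> x applies. Otherwise the left side is at most 1, which the Chernoff weight
        exp(\<kappa> (|h|^2 - s^2/4)) exceeds.\<close>
      show "1 - exp (- ?SY g) \<le> exp (- \<kappa> * s\<^sup>2 / 4) * exp (\<kappa> * h2 g) + real (card V) * exp (\<beta> * (s - t))"
      proof (cases "4 * h2 g \<le> s\<^sup>2")
        case True
        have "Y v g \<le> s" if "v \<in> V" for v
        proof -
          have "Y v g \<le> 2 * sqrt (h2 g)"
            unfolding Y_def sum_ycoef h2_def using sum_inner_le[OF V(2)[OF that], of "\<lambda>i. g (i, (d, 0))"] by simp
          also have "\<dots> = sqrt (4 * h2 g)" by (simp add: real_sqrt_mult)
          also have "\<dots> \<le> s" using True s by (simp add: real_le_lsqrt)
          finally show ?thesis .
        qed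
        then have "?SY g \<le> (\<Sum>v\<in>V. exp (\<beta> * (s - t)))"
          using \<beta> by (intro sum_mono) simp
        moreover have "1 - exp (- ?SY g) \<le> ?SY g"
          using exp_ge_add_one_self[of "- ?SY g"] by simp
        ultimately show ?thesis by (simp add: add_increasing)
      next
        case False
        have "1 \<le> exp (\<kappa> * (h2 g - s\<^sup>2 / 4))" using False \<kappa> by simp
        also have "\<dots> = exp (- \<kappa> * s\<^sup>2 / 4) * exp (\<kappa> * h2 g)"
          by (simp add: mult_exp_exp algebra_simps)
        finally show ?thesis
          by (smt (verit) exp_ge_zero mult_nonneg_nonneg of_nat_0_le_iff)
      qed
    qed
    also have "\<dots> = R + real (card V) * exp (\<beta> * (s - t))"
      using exp_sum_square_integral[OF \<kappa>(2), of d] by (simp add: h2_def R_def P.prob_space)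
    finally show ?thesis .
  qed
  have "((\<lambda>\<beta>. R + real (card V) * exp (\<beta> * (s - t))) \<longlongrightarrow> R + real (card V) * 0) at_top"
  proof (intro tendsto_intros filterlim_compose[OF exp_at_bot])
    show "filterlim (\<lambda>\<beta>. \<beta> * (s - t)) at_bot at_top"
      using s(2) filterlim_tendsto_neg_mult_at_bot[OF tendsto_const[of "s - t"] _ filterlim_ident] by (simp add: mult.commute)
  qed
  then have "measure ?M E * (1 - exp (-1)) \<le> R + real (card V) * 0"
    by (rule tendsto_lowerbound)
      (use bound in \<open>auto intro!: eventually_mono[OF eventually_gt_at_top[of 0]]\<close>)
  \<comment> \<open>This is the source of the factor 2 in the bound.\<close>
  moreover have "1 / 2 \<le> 1 - exp (-1 :: real)"
    using exp_ge_add_one_self[of "1::real"] by (simp add: exp_minus field_simps)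
  then have "measure ?M E * (1 / 2) \<le> measure ?M E * (1 - exp (-1))"
    by (intro mult_left_mono) auto
  ultimately show ?thesis unfolding E_def X_def R_def by simp
qed

text \<open>The matrix entries are a marginal of the extended product, so the event can be lifted
  there and covered by the noisy events for both signs of \<xi>; the union of the two turns the
  factor 2 into 4.\<close>

lemma gue_tail_finite:
  assumes d: "d \<ge> 1" and V: "finite V" "\<And>v. v \<in> V \<Longrightarrow> sqnorm d v = 1"
    and \<kappa>: "0 \<le> \<kappa>" "\<kappa> < 1" and s: "0 \<le> s" "s < t"
  shows "measure (gue_space d) {g \<in> space (gue_space d). \<exists>v\<in>V. t \<le> - qlin d v g}
    \<le> 4 * (exp (- \<kappa> * s\<^sup>2 / 4) * (1 / (1 - \<kappa>)) ^ (d\<^sup>2))"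
proof -
  let ?K = "Idx d \<times> Idx d" and ?J = "ext_idx d"
  let ?M = "\<Pi>\<^sub>M _\<in>?J. cgauss"
  interpret product_prob_space "\<lambda>_::(nat \<times> nat) \<times> (nat \<times> nat). cgauss" ?J
    by (rule product_prob_space_cgauss)
  have sub: "?K \<subseteq> ?J" by (auto simp: ext_idx_def)
  have eq: "gue_space d = distr ?M (gue_space d) (\<lambda>g. \<lambda>p\<in>?K. g p)"
    unfolding gue_space_def
    by (rule distr_PiM_reindex[symmetric, of ?J "\<lambda>_. cgauss" "\<lambda>p. p"]) (use sub prob_space_cgauss in auto)
  have [measurable]: "(\<lambda>g. \<lambda>p\<in>?K. g p) \<in> ?M \<rightarrow>\<^sub>M gue_space d"
    unfolding gue_space_def using sub by (rule measurable_restrict_subset)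
  have [measurable]: "qlin d v \<in> borel_measurable (gue_space d)" for v
    unfolding gue_space_def by (rule qlin_measurable) simp
  let ?A = "\<lambda>\<epsilon>. {g \<in> space ?M. \<exists>v\<in>V. t \<le> (\<Sum>p\<in>?J. xcoef d \<epsilon> v p \<bullet> g p)}"
  have [measurable]: "?A \<epsilon> \<in> sets ?M" for \<epsilon>
  proof -
    have [measurable]: "(\<lambda>g. \<Sum>p\<in>?J. xcoef d \<epsilon> v p \<bullet> g p) \<in> borel_measurable ?M" for v
      by (auto intro!: borel_measurable_sum borel_measurable_inner measurable_PiM_cgauss_component)
    show ?thesis using V(1) by measurable
  qed
  have qr: "qlin d v (\<lambda>p\<in>?K. g p) = qlin d v g" for v g
    by (rule qlin_cong) auto
  have "measure (gue_space d) {g \<in> space (gue_space d). \<exists>v\<in>V. t \<le> - qlin d v g}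
    = measure ?M ((\<lambda>g. \<lambda>p\<in>?K. g p) -` {g \<in> space (gue_space d). \<exists>v\<in>V. t \<le> - qlin d v g} \<inter> space ?M)"
    by (subst eq, rule measure_distr) (use V(1) in measurable)
  also have "\<dots> \<le> measure ?M (?A 1 \<union> ?A (-1))"
  proof (rule finite_measure_mono)
    show "(\<lambda>g. \<lambda>p\<in>?K. g p) -` {g \<in> space (gue_space d). \<exists>v\<in>V. t \<le> - qlin d v g} \<inter> space ?M \<subseteq> ?A 1 \<union> ?A (-1)"
    proof
      fix g assume g: "g \<in> (\<lambda>g. \<lambda>p\<in>?K. g p) -` {g \<in> space (gue_space d). \<exists>v\<in>V. t \<le> - qlin d v g} \<inter> space ?M"
      then obtain v where v: "v \<in> V" "t \<le> - qlin d v g" by (auto simp: qr)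
      define \<xi> where "\<xi> = sqrt (2 * (1 + 1 / (real d)\<^sup>2)) * Re (g ((d, 0), (d, 0)))"
      \<comment> \<open>one of the two signs of the noise does not hurt, so independence of the noise is not needed\<close>
      have "t \<le> - qlin d v g + 1 * \<xi> \<or> t \<le> - qlin d v g + (-1) * \<xi>"
        using v(2) by linarith
      then have "t \<le> (\<Sum>p\<in>?J. xcoef d 1 v p \<bullet> g p) \<or> t \<le> (\<Sum>p\<in>?J. xcoef d (-1) v p \<bullet> g p)"
        unfolding sum_xcoef \<xi>_def .
      then show "g \<in> ?A 1 \<union> ?A (-1)"
        using v(1) g by blast
    qed
  qed measurable
  also have "\<dots> \<le> measure ?M (?A 1) + measure ?M (?A (-1))"
    by (rule measure_Un_le) measurable
  also have "\<dots> \<le> 2 * (exp (- \<kappa> * s\<^sup>2 / 4) * (1 / (1 - \<kappa>)) ^ (d\<^sup>2)) + 2 * (exp (- \<kappa> * s\<^sup>2 / 4) * (1 / (1 - \<kappa>)) ^ (d\<^sup>2))"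
    by (intro add_mono noisy_tail assms) auto
  finally show ?thesis by (simp add: mult_ac)
qed

text \<open>Continuity of measure from below along finite subsets, possible because the finite bound
  does not depend on how many vectors are used.\<close>

lemma gue_tail_countable:
  assumes d: "d \<ge> 1" and V: "countable V" "\<And>v. v \<in> V \<Longrightarrow> sqnorm d v = 1"
    and \<kappa>: "0 \<le> \<kappa>" "\<kappa> < 1" and s: "0 \<le> s" "s < t"
  shows "measure (gue_space d) {g \<in> space (gue_space d). \<exists>v\<in>V. t \<le> - qlin d v g}
    \<le> 4 * (exp (- \<kappa> * s\<^sup>2 / 4) * (1 / (1 - \<kappa>)) ^ (d\<^sup>2))"
proof (cases "V = {}")
  case True
  then show ?thesis using \<kappa> by simp
next
  case False
  interpret prob_space "gue_space d" by (rule prob_space_gue_space)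
  have [measurable]: "qlin d v \<in> borel_measurable (gue_space d)" for v
    unfolding gue_space_def by (rule qlin_measurable) simp
  define A where "A N = {g \<in> space (gue_space d). \<exists>v\<in>from_nat_into V ` {..<N}. t \<le> - qlin d v g}" for N
  have "A N \<in> sets (gue_space d)" for N
  proof -
    have "finite (from_nat_into V ` {..<N})" by simp
    then show ?thesis unfolding A_def by measurable
  qed
  then have "(\<lambda>N. measure (gue_space d) (A N)) \<longlonglongrightarrow> measure (gue_space d) (\<Union>N. A N)"
    by (intro finite_Lim_measure_incseq) (auto simp: A_def incseq_def)
  moreover have "measure (gue_space d) (A N) \<le> 4 * (exp (- \<kappa> * s\<^sup>2 / 4) * (1 / (1 - \<kappa>)) ^ (d\<^sup>2))" for N
    unfolding A_def
    by (intro gue_tail_finite assms) (auto simp: False intro!: V(2) from_nat_into)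
  ultimately have "measure (gue_space d) (\<Union>N. A N) \<le> 4 * (exp (- \<kappa> * s\<^sup>2 / 4) * (1 / (1 - \<kappa>)) ^ (d\<^sup>2))"
    by (intro LIMSEQ_le_const2) auto
  moreover have "(\<Union>N. A N) = {g \<in> space (gue_space d). \<exists>v\<in>V. t \<le> - qlin d v g}"
  proof -
    have "V = (\<Union>N. from_nat_into V ` {..<N})"
      using range_from_nat_into[OF False V(1)] by (auto simp del: range_from_nat_into)
    then show ?thesis unfolding A_def by blast
  qed
  ultimately show ?thesis by simp
qed

text \<open>The form is continuous in the coordinates of v. Extensional functions on the finite
  index set are used because, for countable \<open>Q\<close>, they form a countable set, whereas all
  functions with values in \<open>Q\<close> need not.\<close>

lemma psd_rho_iff_dense:
  fixes Q :: "complex set"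
  assumes d: "d \<ge> 1" and Q: "\<And>X. open X \<Longrightarrow> X \<noteq> {} \<Longrightarrow> \<exists>q\<in>Q. q \<in> X"
  shows "psd (Idx d) (rho \<alpha> d g) \<longleftrightarrow> (\<forall>v\<in>Idx d \<rightarrow>\<^sub>E Q. 0 \<le> sqnorm d v + \<alpha> / real d * qlin d v g)"
proof (unfold psd_rho_iff[OF d], intro iffI ballI allI)
  fix v :: "nat \<times> nat \<Rightarrow> complex"
  assume pos: "\<forall>v\<in>Idx d \<rightarrow>\<^sub>E Q. 0 \<le> sqnorm d v + \<alpha> / real d * qlin d v g"
  have ex: "\<exists>q. q \<in> Q \<and> dist q (v i) < inverse (real (Suc n))" for i n
    using Q[of "ball (v i) (inverse (real (Suc n)))"] by (auto simp: dist_commute)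
  define u where "u n i = (SOME q. q \<in> Q \<and> dist q (v i) < inverse (real (Suc n)))" for n i
  have u: "u n i \<in> Q" "dist (u n i) (v i) < inverse (real (Suc n))" for n i
    using someI_ex[OF ex[of i n]] by (auto simp: u_def)
  have lim: "(\<lambda>n. u n i) \<longlonglongrightarrow> v i" for i
  proof (rule tendstoI)
    fix e :: real assume "e > 0"
    from order_tendstoD(2)[OF LIMSEQ_inverse_real_of_nat this]
    show "\<forall>\<^sub>F n in sequentially. dist (u n i) (v i) < e"
      by (rule eventually_mono) (use u(2) in \<open>meson less_trans\<close>)
  qed
  have "(\<lambda>n. sqnorm d (u n) + \<alpha> / real d * qlin d (u n) g) \<longlonglongrightarrow> sqnorm d v + \<alpha> / real d * qlin d v g"
    unfolding qlin_def qcoef_def sqnorm_def if_distrib[where f = "\<lambda>x. _ - x"]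
    by (intro tendsto_intros lim) (use d in \<open>auto intro!: tendsto_intros lim\<close>)
  moreover have "0 \<le> sqnorm d (u n) + \<alpha> / real d * qlin d (u n) g" for n
  proof -
    have "sqnorm d (restrict (u n) (Idx d)) = sqnorm d (u n)"
      by (simp add: sqnorm_def)
    moreover from this have "qlin d (restrict (u n) (Idx d)) g = qlin d (u n) g"
      unfolding qlin_def qcoef_def by (intro sum.cong) (use d in auto)
    moreover have "restrict (u n) (Idx d) \<in> Idx d \<rightarrow>\<^sub>E Q" using u(1) by auto
    ultimately show ?thesis using pos by metis
  qed
  ultimately show "0 \<le> sqnorm d v + \<alpha> / real d * qlin d v g"
    by (intro LIMSEQ_le_const) auto
qed auto

lemma psd_rho_cong:
  assumes "d \<ge> 1" "\<And>p. p \<in> Idx d \<times> Idx d \<Longrightarrow> g p = h p"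
  shows "psd (Idx d) (rho \<alpha> d g) \<longleftrightarrow> psd (Idx d) (rho \<alpha> d h)"
  unfolding psd_rho_iff[OF assms(1)] using qlin_cong[of d g h] assms(2) by auto

text \<open>Countably many test vectors make the event measurable, and after normalisation a vector
  violating positivity witnesses -<u, G u> \<ge> d/\<alpha> for a unit vector u.\<close>

lemma not_psd_rho_tail:
  assumes d: "d \<ge> 1" and \<alpha>: "\<alpha> > 0"
    and \<kappa>: "0 \<le> \<kappa>" "\<kappa> < 1" and s: "0 \<le> s" "s < real d / \<alpha>"
  shows "{g \<in> space (gue_space d). psd (Idx d) (rho \<alpha> d g)} \<in> sets (gue_space d)"
    and "measure (gue_space d) {g \<in> space (gue_space d). \<not> psd (Idx d) (rho \<alpha> d g)}
      \<le> 4 * (exp (- \<kappa> * s\<^sup>2 / 4) * (1 / (1 - \<kappa>)) ^ (d\<^sup>2))"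
proof -
  interpret prob_space "gue_space d" by (rule prob_space_gue_space)
  have [measurable]: "qlin d v \<in> borel_measurable (gue_space d)" for v
    unfolding gue_space_def by (rule qlin_measurable) simp
  obtain Q :: "complex set" where Q: "countable Q" "\<And>X. open X \<Longrightarrow> X \<noteq> {} \<Longrightarrow> \<exists>q\<in>Q. q \<in> X"
    using countable_dense_setE by blast
  let ?D = "Idx d \<rightarrow>\<^sub>E Q"
  have psd_iff: "psd (Idx d) (rho \<alpha> d g) \<longleftrightarrow> (\<forall>v\<in>?D. 0 \<le> sqnorm d v + \<alpha> / real d * qlin d v g)" for g
    by (rule psd_rho_iff_dense[OF d Q(2)])
  have D: "countable ?D" by (intro countable_PiE Q(1)) auto
  show "{g \<in> space (gue_space d). psd (Idx d) (rho \<alpha> d g)} \<in> sets (gue_space d)"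
    unfolding psd_iff using D by measurable
  \<comment> \<open>Normalised dense vectors. Vectors of norm 0 may be dropped: their form vanishes,
    so they never violate positivity.\<close>
  define U where "U = (\<lambda>v i. complex_of_real (1 / sqrt (sqnorm d v)) * v i) ` {v \<in> ?D. sqnorm d v \<noteq> 0}"
  have nonneg: "0 \<le> sqnorm d v" for v by (simp add: sqnorm_def sum_nonneg)
  have U: "countable U" unfolding U_def using D by (intro countable_image) (auto intro: countable_subset)
  have U1: "sqnorm d u = 1" if u: "u \<in> U" for u
  proof -
    obtain v where v: "u = (\<lambda>i. complex_of_real (1 / sqrt (sqnorm d v)) * v i)" "sqnorm d v \<noteq> 0"
      using u by (auto simp: U_def)
    have "sqnorm d u = (1 / sqrt (sqnorm d v))\<^sup>2 * sqnorm d v"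
      unfolding v(1) unfolding sqnorm_def[of d "\<lambda>i. _ * v i"]
      unfolding norm_mult power_mult_distrib norm_of_real power2_abs sum_distrib_left[symmetric] sqnorm_def[symmetric] ..
    then show ?thesis using v(2) nonneg[of v] by (simp add: power_divide)
  qed
  have [measurable]: "{g \<in> space (gue_space d). \<exists>u\<in>U. real d / \<alpha> \<le> - qlin d u g} \<in> sets (gue_space d)"
    using U by measurable
  have "measure (gue_space d) {g \<in> space (gue_space d). \<not> psd (Idx d) (rho \<alpha> d g)}
    \<le> measure (gue_space d) {g \<in> space (gue_space d). \<exists>u\<in>U. real d / \<alpha> \<le> - qlin d u g}"
  proof (rule finite_measure_mono)
    show "{g \<in> space (gue_space d). \<not> psd (Idx d) (rho \<alpha> d g)}
        \<subseteq> {g \<in> space (gue_space d). \<exists>u\<in>U. real d / \<alpha> \<le> - qlin d u g}"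
    proof (intro Collect_mono impI, elim conjE, intro conjI)
      fix g assume "\<not> psd (Idx d) (rho \<alpha> d g)"
      then obtain v where v: "v \<in> ?D" "sqnorm d v + \<alpha> / real d * qlin d v g < 0"
        unfolding psd_iff by (auto simp: not_le)
      have nz: "sqnorm d v \<noteq> 0"
      proof
        assume z: "sqnorm d v = 0"
        then have "v i = 0" if "i \<in> Idx d" for i
          using that by (simp add: sqnorm_def sum_nonneg_eq_0_iff)
        then have "qlin d v g = 0"
          unfolding qlin_def qcoef_def using z by (intro sum.neutral) auto
        then show False using v(2) z by simp
      qed
      then have pos: "sqnorm d v > 0" using nonneg[of v] by simp
      let ?u = "\<lambda>i. complex_of_real (1 / sqrt (sqnorm d v)) * v i"
      have "qlin d ?u g = qlin d v g / sqnorm d v"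
        unfolding qlin_scale using pos by (simp add: power_divide)
      moreover have "real d / \<alpha> * sqnorm d v \<le> - qlin d v g"
        using v(2) d \<alpha> by (simp add: field_simps)
      ultimately have "real d / \<alpha> \<le> - qlin d ?u g"
        using pos by (simp only: minus_divide_left pos_le_divide_eq)
      moreover have "?u \<in> U" unfolding U_def using v(1) nz by blast
      ultimately show "\<exists>u\<in>U. real d / \<alpha> \<le> - qlin d u g" by blast
    qed
  qed measurable
  also have "\<dots> \<le> 4 * (exp (- \<kappa> * s\<^sup>2 / 4) * (1 / (1 - \<kappa>)) ^ (d\<^sup>2))"
    by (intro gue_tail_countable d U U1 \<kappa> s)
  finally show "measure (gue_space d) {g \<in> space (gue_space d). \<not> psd (Idx d) (rho \<alpha> d g)}
      \<le> 4 * (exp (- \<kappa> * s\<^sup>2 / 4) * (1 / (1 - \<kappa>)) ^ (d\<^sup>2))" .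
qed

text \<open>The entries are independent and identically distributed, so reindexing by an injection
  of the index set into itself preserves the product measure. The restriction in \<open>T\<close>
  keeps its values in the extensional functions that form the space.\<close>

lemma ptrans_measure_preserving:
  assumes d: "d \<ge> 1"
  defines "\<tau> \<equiv> \<lambda>p :: (nat \<times> nat) \<times> (nat \<times> nat). ((fst (fst p), snd (snd p)), (fst (snd p), snd (fst p)))"
  defines "T \<equiv> \<lambda>g :: (nat \<times> nat) \<times> (nat \<times> nat) \<Rightarrow> complex. \<lambda>p\<in>Idx d \<times> Idx d. g (\<tau> p)"
  shows "distr (gue_space d) (gue_space d) T = gue_space d"
    and "T \<in> gue_space d \<rightarrow>\<^sub>M gue_space d"
    and "psd (Idx d) (ptrans (rho \<alpha> d g)) \<longleftrightarrow> psd (Idx d) (rho \<alpha> d (T g))"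
proof -
  have \<tau>: "\<tau> \<in> Idx d \<times> Idx d \<rightarrow> Idx d \<times> Idx d" "inj_on \<tau> (Idx d \<times> Idx d)"
    by (auto simp: \<tau>_def Idx_def inj_on_def)
  show "distr (gue_space d) (gue_space d) T = gue_space d"
    unfolding gue_space_def T_def
    by (rule distr_PiM_reindex[OF _ \<tau>(2) \<tau>(1)]) (rule prob_space_cgauss)
  show "T \<in> gue_space d \<rightarrow>\<^sub>M gue_space d"
    unfolding gue_space_def T_def
    by (intro measurable_restrict measurable_component_singleton) (use \<tau>(1) in auto)
  show "psd (Idx d) (ptrans (rho \<alpha> d g)) \<longleftrightarrow> psd (Idx d) (rho \<alpha> d (T g))"
    unfolding ptrans_rho by (rule psd_rho_cong[OF d]) (simp add: T_def \<tau>_def)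
qed

theorem theorem13:
  fixes \<alpha> :: real
  assumes "0 < \<alpha>" and "\<alpha> < 1/2"
  shows "\<exists>c>0. \<forall>d::nat. d \<ge> 1 \<longrightarrow>
    measure (gue_space d)
      {g \<in> space (gue_space d). psd (Idx d) (rho \<alpha> d g) \<and> psd (Idx d) (ptrans (rho \<alpha> d g))}
    \<ge> 1 - 2 * exp (- c * (real d)\<^sup>2)"
proof -
  \<comment> \<open>The midpoint of 2 and 1/\<alpha>: below 1/\<alpha> it leaves the gap s < t for s
    = \<sigma> d and t = d/\<alpha>, above 2 it makes r exceed 1.\<close>
  define \<sigma> where "\<sigma> = (2 + 1 / \<alpha>) / 2"
  have "2 < 1 / \<alpha>" using assms by (simp add: field_simps)
  then have \<sigma>: "2 < \<sigma>" "\<sigma> < 1 / \<alpha>" by (simp_all add: \<sigma>_def)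
  \<comment> \<open>The ratio of the cutoff s^2/4 = \<sigma>^2 d^2 / 4 for |h|^2 to its mean
    d^2.\<close>
  define r where "r = \<sigma>\<^sup>2 / 4"
  have r: "1 < r"
    using power_strict_mono[OF \<sigma>(1), of 2] by (simp add: r_def)
  \<comment> \<open>the minimiser of the Chernoff bound \<open>exp (- \<kappa> * r) / (1 - \<kappa>)\<close>\<close>
  define \<kappa> where "\<kappa> = 1 - 1 / r"
  have \<kappa>: "0 \<le> \<kappa>" "\<kappa> < 1" using r by (simp_all add: \<kappa>_def)
  \<comment> \<open>The optimal Chernoff exponent per coordinate, positive because ln r < r - 1 for
    r different from 1.\<close>
  define e where "e = r - 1 - ln r"
  have "e > 0"
    using ln_le_minus_one[of r] ln_eq_minus_one[of r] r by (auto simp: e_def less_le)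
  have main: "1 - 2 * exp (- (e / 4) * (real d)\<^sup>2) \<le> measure (gue_space d)
      {g \<in> space (gue_space d). psd (Idx d) (rho \<alpha> d g) \<and> psd (Idx d) (ptrans (rho \<alpha> d g))}"
    if d: "d \<ge> 1" for d :: nat
  proof -
    let ?M = "gue_space d"
    interpret prob_space ?M by (rule prob_space_gue_space)
    let ?T = "\<lambda>g :: (nat \<times> nat) \<times> (nat \<times> nat) \<Rightarrow> complex. \<lambda>p\<in>Idx d \<times> Idx d. g ((fst (fst p), snd (snd p)), (fst (snd p), snd (fst p)))"
    note T = ptrans_measure_preserving[OF d]
    note T(2)[measurable]
    let ?A = "{g \<in> space ?M. psd (Idx d) (rho \<alpha> d g)}"
    let ?N = "{g \<in> space ?M. \<not> psd (Idx d) (rho \<alpha> d g)}"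
    define R where "R = 4 * (exp (- \<kappa> * (\<sigma> * real d)\<^sup>2 / 4) * (1 / (1 - \<kappa>)) ^ (d\<^sup>2))"
    have s: "0 \<le> \<sigma> * real d" "\<sigma> * real d < real d / \<alpha>"
      using \<sigma> d assms(1) by (auto simp: field_simps)
    note tail = not_psd_rho_tail[OF d assms(1) \<kappa> s]
    note A [measurable] = tail(1)
    have N_eq: "?N = space ?M - ?A" by auto
    have N [measurable]: "?N \<in> sets ?M" unfolding N_eq by measurable
    have N_le: "prob ?N \<le> R" using tail(2) unfolding R_def .
    let ?N' = "?T -` ?N \<inter> space ?M"
    have "prob ?N' = measure (distr ?M ?M ?T) ?N"
      by (rule measure_distr[symmetric]) measurable
    then have N'_le: "prob ?N' \<le> R" using N_le T(1) by simp
    have N' [measurable]: "?N' \<in> sets ?M" by measurable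
    have good: "{g \<in> space ?M. psd (Idx d) (rho \<alpha> d g) \<and> psd (Idx d) (ptrans (rho \<alpha> d g))} = space ?M - (?N \<union> ?N')"
      using measurable_space[OF T(2)] by (auto simp: T(3) simp del: space_gue_space)
    have "1 - 2 * R \<le> 1 - (prob ?N + prob ?N')" using N_le N'_le by simp
    also have "\<dots> \<le> 1 - prob (?N \<union> ?N')"
      using measure_Un_le[OF N N'] by simp
    also have "\<dots> = prob (space ?M - (?N \<union> ?N'))"
      by (rule prob_compl[symmetric]) measurable
    finally have lower: "1 - 2 * R \<le> prob (space ?M - (?N \<union> ?N'))" .
    \<comment> \<open>The quarter of the rate pays for the prefactor: 4 exp(-e d^2) \<le> exp(-e d^2
      / 4) needs (3/4) e d^2 \<ge> 2 ln 2, which holds once e d^2 \<ge> 4 ln 2. Below that threshold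
      exp(-e d^2 / 4) is at least 1/2.\<close>
    show ?thesis
    proof (cases "e * (real d)\<^sup>2 < 4 * ln 2")
      case True
      \<comment> \<open>for small \<open>d\<close> the claimed lower bound is not positive\<close>
      have "exp (- ln 2) \<le> exp (- (e / 4) * (real d)\<^sup>2)"
        using True by simp
      then have "1 - 2 * exp (- (e / 4) * (real d)\<^sup>2) \<le> 0"
        by (simp add: exp_minus)
      then show ?thesis using measure_nonneg order_trans by blast
    next
      case False
      have "R = 4 * exp (- e * (real d)\<^sup>2)"
      proof -
        have "(1 / (1 - \<kappa>)) ^ (d\<^sup>2) = exp (ln r) ^ (d\<^sup>2)" using r by (simp add: \<kappa>_def)
        also have "\<dots> = exp ((real d)\<^sup>2 * ln r)" by (simp add: exp_of_nat_mult[symmetric])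
        finally have "R = 4 * exp (- \<kappa> * (\<sigma> * real d)\<^sup>2 / 4 + (real d)\<^sup>2 * ln r)"
          unfolding R_def exp_add by simp
        moreover have "\<kappa> * (\<sigma> * real d)\<^sup>2 / 4 = (r - 1) * (real d)\<^sup>2"
        proof -
          have "\<kappa> * (\<sigma> * real d)\<^sup>2 / 4 = (\<kappa> * r) * (real d)\<^sup>2"
            by (simp add: r_def power_mult_distrib)
          also have "\<kappa> * r = r - 1" using r by (simp add: \<kappa>_def field_simps)
          finally show ?thesis .
        qed
        ultimately show ?thesis by (simp add: e_def algebra_simps)
      qed
      also have "\<dots> = exp (2 * ln 2 + - e * (real d)\<^sup>2)"
        by (simp only: exp_add) (simp add: exp_double)
      also have "\<dots> \<le> exp (- (e / 4) * (real d)\<^sup>2)"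
      proof -
        have "0 < ln (2::real)" by simp
        then have "2 * ln 2 - e * (real d)\<^sup>2 \<le> - (e * (real d)\<^sup>2 / 4)"
          using False by linarith
        then show ?thesis by simp
      qed
      finally show ?thesis using lower unfolding good by linarith
    qed
  qed
  show ?thesis
    by (rule exI[of _ "e / 4"]) (use main \<open>e > 0\<close> in auto)
qed

end
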